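(* Let $\sigma_1,\sigma_2,\gamma,\gamma_*$ be vessel parameters on an interval $\mathrm I$ containing $[t_2^0,T]$. Let $H_n(t_2)$, $n\ge0$, be $\mathbb C^{p\times p}$-valued moments constructed so that $$\gamma_*-\gamma=\sigma_2H_0-\sigma_1H_0\sigma_1^{-1}\sigma_2,$$ $$\sigma_1^{-1}\sigma_2H_{n+1}-H_{n+1}\sigma_1^{-1}\sigma_2=\frac{d}{dt_2}H_n-\sigma_1^{-1}\gamma_*H_n+H_n\sigma_1^{-1}\gamma,$$ $$H_{n+1}\sigma_1^{-1}+(-1)^n\sigma_1^{-1}H_{n+1}^*=\sum_{j=0}^n(-1)^{j+1}H_{n-j}\sigma_1^{-1}H_j^*,$$ and let $K_0,K_1,K_2,K_3$ be the coefficients, depending on the vessel parameters only, such that $\frac{d}{dt_2}H_{n+1}=K_0H_n+K_1\frac{d}{dt_2}H_n+K_2\frac{d^2}{dt_2^2}H_n+K_3\frac{d^3}{dt_2^3}H_n$ for all $n$. Suppose that the vessel parameters and the norm are chosen so that for all $k\ge1$ $$\|K_i^{(k)}(t_2)\|\le\frac{d^k}{dt_2^k}\|K_i(t_2)\|,\qquad i=0,1,2,3.$$ Suppose also that, for a constant $C>0$, $M(t_2)$ is a positive function with positive derivatives on $[t_2^0,T]$ which is a solution of $$\frac{C}{3\sqrt2}\frac{d}{dt_2}M=\|K_0\|M+\|K_1\|\frac{d}{dt_2}M+\|K_2\|\frac{d^2}{dt_2^2}M+\|K_3\|\frac{d^3}{dt_2^3}M$$ with initial value $M(t_2^0)=1$,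 and which majorizes $H_0$ and all its derivatives: $\|H_0^{(k)}(t_2)\|\le f_0C\,M^{(k)}(t_2)$ on $[t_2^0,T]$ for all $k\ge0$. Suppose finally that at each step the imaginary part (for even $n$), respectively the real part (for odd $n$), of $H_{n+1}\sigma_1^{-1}$ satisfies $$\|H_{n+1}(t_2^0)\sigma_1^{-1}-(-1)^n\sigma_1^{-1}H_{n+1}^*(t_2^0)\|\le f_{n+1}C^{n+2}.$$ Then the series $$I-\sum_{n=0}^\infty\frac{1}{\lambda^{n+1}}H_n(t_2)$$ determines a function $S(\lambda,t_2)$, analytic at $\lambda=\infty$, not necessarily $\sigma_1(t_2)$-contractive (i.e. $S^*\sigma_1S\le\sigma_1$ for $\Re\lambda>0$ need not hold), which maps solutions of $\lambda\sigma_2u-\sigma_1\frac{\partial u}{\partial t_2}+\gamma u=0$ to solutions of $\lambda\sigma_2y-\sigma_1\frac{\partial y}{\partial t_2}+\gamma_*y=0$ and which is symmetric, i.e. $S(\lambda,t_2)=\sigma_1^{-1}(t_2)\big(S(-\bar\lambda,t_2)^{-1}\big)^*\sigma_1(t_2)$. The radius of convergence around $\lambda=\infty$ is at least $\frac1{4C}$.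
   Context: Vessel parameters: continuous functions $\sigma_1,\sigma_2,\gamma,\gamma_*:\mathrm I\to\mathbb C^{p\times p}$ such that $\sigma_1,\sigma_2$ take self-adjoint values, $\sigma_1$ is differentiable with invertible values, and $\gamma+\gamma^*=\gamma_*+\gamma_*^*=-\frac{d}{dt_2}\sigma_1$. The parameters and moments are assumed differentiable as often as needed. The $K_i(t_2)$ act linearly on $p\times p$ matrices. The real and imaginary parts of a square matrix $Z$ are $\frac12(Z+Z^* )$ and $\frac1{2i}(Z-Z^* )$. A superscript $(k)$ denotes the $k$-th derivative in $t_2$. The numbers $f_n$ are defined by $f_0=1$ and $f_{n+1}=\|\sigma_1^{-1}\|\sum_{j=0}^nf_{n-j}f_j$. Radius of convergence around $\lambda=\infty$ is meant in the variable $1/\lambda$.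
   Formalization: As stated false. H_0σ_1^{-1} is also assumed self-adjoint, and with r=max(‖σ_1^{-1}‖,‖σ_1‖‖σ_1^{-1}‖) at t_2^0 the results hold for |λ|>4Cr with radius at least 1/(4Cr); the bound 1/(4C) is claimed only when r=1. *)

theory Defs
  imports "HOL-Complex_Analysis.Complex_Analysis"
begin

type_synonym 'n cmat = "complex^'n^'n"

definition cscale :: "complex \<Rightarrow> 'n::finite cmat \<Rightarrow> 'n cmat" where
  "cscale c A = (\<chi> i j. c * A $ i $ j)"

definition ctrans :: "'n::finite cmat \<Rightarrow> 'n cmat" where
  "ctrans A = (\<chi> i j. cnj (A $ j $ i))"

text \<open>Derivatives are taken within the interval \<open>X\<close>, so they are one-sided at an
  end point belonging to \<open>X\<close>. Used only for intervals with more than one point, where these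
  derivatives are unique.\<close>

definition nderiv :: "real set \<Rightarrow> nat \<Rightarrow> (real \<Rightarrow> 'a::real_normed_vector) \<Rightarrow> real \<Rightarrow> 'a" where
  "nderiv X k f = ((\<lambda>g s. vector_derivative g (at s within X)) ^^ k) f"

definition smooth_within :: "real set \<Rightarrow> (real \<Rightarrow> 'a::real_normed_vector) \<Rightarrow> bool" where
  "smooth_within X f \<longleftrightarrow> (\<forall>k. \<forall>t\<in>X. nderiv X k f differentiable (at t within X))"

definition vessel_parameters ::
  "real set \<Rightarrow> (real \<Rightarrow> 'n::finite cmat) \<Rightarrow> (real \<Rightarrow> 'n cmat) \<Rightarrow> (real \<Rightarrow> 'n cmat)
    \<Rightarrow> (real \<Rightarrow> 'n cmat) \<Rightarrow> bool" where
  "vessel_parameters I \<sigma>1 \<sigma>2 \<gamma> \<gamma>s \<longleftrightarrow>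
     continuous_on I \<sigma>1 \<and> continuous_on I \<sigma>2 \<and> continuous_on I \<gamma> \<and> continuous_on I \<gamma>s \<and>
     (\<forall>t\<in>I. ctrans (\<sigma>1 t) = \<sigma>1 t \<and> ctrans (\<sigma>2 t) = \<sigma>2 t \<and> invertible (\<sigma>1 t) \<and>
        \<sigma>1 differentiable (at t within I) \<and>
        \<gamma> t + ctrans (\<gamma> t) = - nderiv I 1 \<sigma>1 t \<and>
        \<gamma>s t + ctrans (\<gamma>s t) = - nderiv I 1 \<sigma>1 t)"

text \<open>The relations obtained by comparing coefficients of powers of \<open>1/\<lambda>\<close> in the differential
  equation and in the symmetry condition for \<open>I - (\<Sum>n. H n / \<lambda>^(n+1))\<close>. The second line,
  self-adjointness of \<open>H 0 \<sigma>1\<^sup>-\<^sup>1\<close>, is the last relation for \<open>n = -1\<close>, where the sum is empty;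
  it does not follow from the other relations, and the symmetry condition fails without it.\<close>

definition vessel_moments ::
  "real set \<Rightarrow> (real \<Rightarrow> 'n::finite cmat) \<Rightarrow> (real \<Rightarrow> 'n cmat) \<Rightarrow> (real \<Rightarrow> 'n cmat)
    \<Rightarrow> (real \<Rightarrow> 'n cmat) \<Rightarrow> (nat \<Rightarrow> real \<Rightarrow> 'n cmat) \<Rightarrow> bool" where
  "vessel_moments I \<sigma>1 \<sigma>2 \<gamma> \<gamma>s H \<longleftrightarrow>
     (\<forall>t\<in>I. let R = matrix_inv (\<sigma>1 t) in
        \<gamma>s t - \<gamma> t = \<sigma>2 t ** H 0 t - \<sigma>1 t ** H 0 t ** R ** \<sigma>2 t \<and>
        H 0 t ** R - R ** ctrans (H 0 t) = 0 \<and>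
        (\<forall>n. R ** \<sigma>2 t ** H (Suc n) t - H (Suc n) t ** R ** \<sigma>2 t
               = nderiv I 1 (H n) t - R ** \<gamma>s t ** H n t + H n t ** R ** \<gamma> t) \<and>
        (\<forall>n. H (Suc n) t ** R + (-1) ^ n *\<^sub>R (R ** ctrans (H (Suc n) t))
               = (\<Sum>j\<le>n. (-1) ^ (j + 1) *\<^sub>R (H (n - j) t ** R ** ctrans (H j t)))))"

definition moment_coefficients ::
  "real set \<Rightarrow> (nat \<Rightarrow> real \<Rightarrow> 'n::finite cmat)
    \<Rightarrow> (nat \<Rightarrow> real \<Rightarrow> 'n cmat \<Rightarrow>\<^sub>L 'n cmat) \<Rightarrow> bool" where
  "moment_coefficients I H K \<longleftrightarrow>
     (\<forall>n. \<forall>t\<in>I. nderiv I 1 (H (Suc n)) t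
        = (\<Sum>i\<le>3. blinfun_apply (K i t) (nderiv I i (H n) t)))"

text \<open>``The norm'': an arbitrary submultiplicative norm on matrices that is invariant under
  the adjoint (the operator norm, for instance), together with any norm on the operators acting
  on matrices that is consistent with it, such as the induced one.\<close>

definition star_matrix_norm :: "('n::finite cmat \<Rightarrow> real) \<Rightarrow> bool" where
  "star_matrix_norm N \<longleftrightarrow>
     (\<forall>A. N A = 0 \<longleftrightarrow> A = 0) \<and> (\<forall>A B. N (A + B) \<le> N A + N B) \<and>
     (\<forall>c A. N (cscale c A) = cmod c * N A) \<and>
     (\<forall>A B. N (A ** B) \<le> N A * N B) \<and> (\<forall>A. N (ctrans A) = N A)"

definition consistent_norm ::
  "('n::finite cmat \<Rightarrow> real) \<Rightarrow> (('n cmat \<Rightarrow>\<^sub>L 'n cmat) \<Rightarrow> real) \<Rightarrow> bool" where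
  "consistent_norm N NK \<longleftrightarrow>
     (\<forall>L. NK L = 0 \<longleftrightarrow> L = 0) \<and> (\<forall>L L'. NK (L + L') \<le> NK L + NK L') \<and>
     (\<forall>c L. NK (c *\<^sub>R L) = \<bar>c\<bar> * NK L) \<and>
     (\<forall>L A. N (blinfun_apply L A) \<le> NK L * N A)"

fun fnum :: "real \<Rightarrow> nat \<Rightarrow> real" where
  "fnum a 0 = 1"
| "fnum a (Suc n) = a * (\<Sum>j\<le>n. fnum a (n - j) * fnum a j)"

text \<open>The numbers \<open>f\<close> are formed with the value of \<open>\<sigma>1\<^sup>-\<^sup>1\<close> at \<open>t0\<close>, the only point where
  an \<open>f n\<close> with \<open>n > 0\<close> is used. The coefficients \<open>K\<close> only have to satisfy the recursion for the
  moments at hand.\<close>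

definition majorized_vessel ::
  "real set \<Rightarrow> real \<Rightarrow> real \<Rightarrow> (real \<Rightarrow> 'n::finite cmat) \<Rightarrow> (real \<Rightarrow> 'n cmat)
    \<Rightarrow> (real \<Rightarrow> 'n cmat) \<Rightarrow> (real \<Rightarrow> 'n cmat) \<Rightarrow> (nat \<Rightarrow> real \<Rightarrow> 'n cmat)
    \<Rightarrow> (nat \<Rightarrow> real \<Rightarrow> 'n cmat \<Rightarrow>\<^sub>L 'n cmat) \<Rightarrow> ('n cmat \<Rightarrow> real)
    \<Rightarrow> (('n cmat \<Rightarrow>\<^sub>L 'n cmat) \<Rightarrow> real) \<Rightarrow> real \<Rightarrow> (real \<Rightarrow> real) \<Rightarrow> bool" where
  "majorized_vessel I t0 T \<sigma>1 \<sigma>2 \<gamma> \<gamma>s H K N NK C M \<longleftrightarrow>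
    (let J = {t0..T}; R0 = matrix_inv (\<sigma>1 t0); f = fnum (N R0) in
     is_interval I \<and> t0 < T \<and> J \<subseteq> I \<and>
     vessel_parameters I \<sigma>1 \<sigma>2 \<gamma> \<gamma>s \<and>
     smooth_within I \<sigma>1 \<and> smooth_within I \<sigma>2 \<and> smooth_within I \<gamma> \<and> smooth_within I \<gamma>s \<and>
     vessel_moments I \<sigma>1 \<sigma>2 \<gamma> \<gamma>s H \<and> (\<forall>n. smooth_within I (H n)) \<and>
     moment_coefficients I H K \<and> (\<forall>i\<le>3. smooth_within I (K i)) \<and>
     star_matrix_norm N \<and> consistent_norm N NK \<and>
     (\<forall>i\<le>3. smooth_within J (\<lambda>t. NK (K i t)) \<and>
        (\<forall>k\<ge>1. \<forall>t\<in>J. NK (nderiv I k (K i) t) \<le> nderiv J k (\<lambda>s. NK (K i s)) t)) \<and>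
     0 < C \<and> smooth_within J M \<and> (\<forall>k. \<forall>t\<in>J. 0 < nderiv J k M t) \<and>
     (\<forall>t\<in>J. C / (3 * sqrt 2) * nderiv J 1 M t = (\<Sum>i\<le>3. NK (K i t) * nderiv J i M t)) \<and>
     M t0 = 1 \<and>
     (\<forall>k. \<forall>t\<in>J. N (nderiv I k (H 0) t) \<le> f 0 * C * nderiv J k M t) \<and>
     (\<forall>n. N (H (Suc n) t0 ** R0 - (-1) ^ n *\<^sub>R (R0 ** ctrans (H (Suc n) t0)))
            \<le> f (Suc n) * C ^ (n + 2)))"

definition transfer_fn :: "(nat \<Rightarrow> real \<Rightarrow> 'n::finite cmat) \<Rightarrow> complex \<Rightarrow> real \<Rightarrow> 'n cmat" where
  "transfer_fn H z t = mat 1 - (\<Sum>n. cscale (1 / z ^ (n + 1)) (H n t))"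

text \<open>Coefficients of the series in the variable \<open>1/\<lambda>\<close>, so that \<^const>\<open>conv_radius\<close> of this
  sequence is the radius of convergence around infinity.\<close>

definition transfer_coeff :: "(nat \<Rightarrow> real \<Rightarrow> 'n::finite cmat) \<Rightarrow> real \<Rightarrow> nat \<Rightarrow> 'n cmat" where
  "transfer_coeff H t n = (case n of 0 \<Rightarrow> mat 1 | Suc m \<Rightarrow> - H m t)"

definition analytic_at_infinity :: "(complex \<Rightarrow> 'n::finite cmat) \<Rightarrow> bool" where
  "analytic_at_infinity F \<longleftrightarrow>
     (\<forall>i j. \<exists>g. g analytic_on {0} \<and> (\<forall>\<^sub>F z in at_infinity. F z $ i $ j = g (1 / z)))"

definition solves_vessel_ode ::
  "real set \<Rightarrow> (real \<Rightarrow> 'n::finite cmat) \<Rightarrow> (real \<Rightarrow> 'n cmat) \<Rightarrow> (real \<Rightarrow> 'n cmat) \<Rightarrow> complex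
    \<Rightarrow> (real \<Rightarrow> complex^'n) \<Rightarrow> bool" where
  "solves_vessel_ode J \<sigma>1 \<sigma>2 \<gamma> z u \<longleftrightarrow>
     (\<forall>t\<in>J. \<exists>u'. (u has_vector_derivative u') (at t within J) \<and>
        z *s (\<sigma>2 t *v u t) - \<sigma>1 t *v u' + \<gamma> t *v u t = 0)"

definition quad_form :: "'n::finite cmat \<Rightarrow> complex^'n \<Rightarrow> complex" where
  "quad_form A v = (\<Sum>i\<in>UNIV. cnj (v $ i) * (A *v v) $ i)"

definition loewner_le :: "'n::finite cmat \<Rightarrow> 'n cmat \<Rightarrow> bool" where
  "loewner_le A B \<longleftrightarrow> ctrans (B - A) = B - A \<and> (\<forall>v. 0 \<le> Re (quad_form (B - A) v))"

text \<open>The moments are bounded through \<open>H \<sigma>1\<^sup>-\<^sup>1\<close>, and the numbers \<open>f\<close> grow like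
  \<open>(4 \<parallel>\<sigma>1\<^sup>-\<^sup>1\<parallel>)^n\<close>. The factor below accounts for the size of \<open>\<sigma>1\<close>; it is always at least 1,
  and equals 1 exactly when \<open>\<parallel>\<sigma>1\<^sup>-\<^sup>1\<parallel> \<le> 1\<close> and \<open>\<parallel>\<sigma>1\<parallel> \<parallel>\<sigma>1\<^sup>-\<^sup>1\<parallel> = 1\<close>, as for a signature
  matrix and the operator norm. Without this normalization, \<open>1/(4C)\<close> is not a lower bound of the
  radius of convergence.\<close>

definition size_factor :: "('n::finite cmat \<Rightarrow> real) \<Rightarrow> 'n cmat \<Rightarrow> real" where
  "size_factor N \<sigma> = max (N (matrix_inv \<sigma>)) (N \<sigma> * N (matrix_inv \<sigma>))"

end

theory Submission
  imports Defs
begin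

text \<open>The proof splits into an estimate of the moments and an algebraic part in which the relations for
  the moments are read as identities between power series in \<open>1/\<lambda>\<close>.

  The estimate, \<open>\<parallel>H\<^sub>n\<^sup>(\<^sup>k\<^sup>)(t)\<parallel> \<le> f\<^sub>n C\<^sup>n\<^sup>+\<^sup>1 M\<^sup>(\<^sup>k\<^sup>)(t)\<close> (\<open>moment_le\<close>), is proved by induction on
  \<open>n\<close>, for all \<open>k\<close> and \<open>t\<close> simultaneously. Here \<open>f\<^sub>n\<close> is formed with the size factor \<open>r\<close>, which is
  at least \<open>\<parallel>\<sigma>1\<^sup>-\<^sup>1\<parallel>\<close> and \<open>\<parallel>\<sigma>1\<parallel> \<parallel>\<sigma>1\<^sup>-\<^sup>1\<parallel>\<close>. For \<open>k \<ge> 1\<close> the recursion for the derivative of \<open>H\<^sub>n\<^sub>+\<^sub>1\<close>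
  and the differential equation for \<open>M\<close> have the same shape, and every derivative of a coefficient
  \<open>K\<^sub>i\<close> is dominated by the same derivative of \<open>\<parallel>K\<^sub>i\<parallel>\<close>; so the product rule, applied on both sides,
  preserves domination (\<open>leibniz_majorant\<close>). For \<open>k = 0\<close> the moment is the integral of its derivative
  plus its initial value (\<open>mean_value_inequality\<close>). The initial value is controlled because one part
  of \<open>H\<^sub>n\<^sub>+\<^sub>1 \<sigma>1\<^sup>-\<^sup>1\<close> is a convolution of earlier moments, which the convolution defining \<open>f\<^sub>n\<^sub>+\<^sub>1\<close>
  dominates, while the other part is bounded by hypothesis (\<open>initial_moment_le\<close>). The generating
  function of the \<open>f\<^sub>n\<close> is finite at \<open>1/(4 r)\<close> (\<open>fnum_le_power\<close>), so the moments and their first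
  derivatives grow at most like \<open>(4 C r)\<^sup>n\<close>, uniformly on the interval.

  This gives convergence for \<open>\<bar>\<lambda>\<bar> > 4 C r\<close> and permits termwise differentiation and multiplication of
  the series. The linear relations for the moments then say that \<open>S\<close> intertwines the two differential
  equations (\<open>intertwining_identity\<close>), and the quadratic ones that
  \<open>S(\<lambda>) \<sigma>1\<^sup>-\<^sup>1 S(- cnj \<lambda>)\<^sup>* = \<sigma>1\<^sup>-\<^sup>1\<close> (\<open>transfer_symmetry_product\<close>).

  Contractivity does not follow: the scalar function \<open>(\<lambda> + b) / (\<lambda> - b)\<close> with small \<open>b > 0\<close> satisfies
  all hypotheses, for constant vessel parameters and \<open>M = exp\<close>, and has modulus greater than \<open>1\<close> in the
  right half plane.\<close>

no_notation fps_nth (infixl "$" 75)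

section \<open>Matrix algebra\<close>

lemma cscale_nth [simp]: "cscale c A $ i $ j = c * A $ i $ j"
  by (simp add: cscale_def)

lemma ctrans_nth [simp]: "ctrans A $ i $ j = cnj (A $ j $ i)"
  by (simp add: ctrans_def)

lemma cscale_cscale [simp]: "cscale c (cscale d A) = cscale (c * d) A"
  by (simp add: vec_eq_iff mult.assoc)

lemma cscale_1 [simp]: "cscale 1 A = A"
  by (simp add: vec_eq_iff)

lemma ctrans_cscale: "ctrans (cscale c A) = cscale (cnj c) (ctrans A)"
  by (simp add: vec_eq_iff)

lemma cscale_matrix_vector: "z *s (A *v v) = cscale z A *v v"
  by (simp add: vec_eq_iff matrix_vector_mult_def sum_distrib_left mult.assoc)

lemma cscale_mult_left: "cscale c A ** B = cscale c (A ** B)"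
  by (simp add: vec_eq_iff matrix_matrix_mult_def sum_distrib_left mult.assoc)

lemma cscale_mult_right: "A ** cscale c B = cscale c (A ** B)"
  by (simp add: vec_eq_iff matrix_matrix_mult_def sum_distrib_left mult.left_commute)

lemma cscale_of_real: "cscale (of_real c) A = c *\<^sub>R A"
  by (simp add: vec_eq_iff scaleR_conv_of_real[where ?'a = complex])

lemma ctrans_mult: "ctrans (A ** B) = ctrans B ** ctrans A"
  by (simp add: vec_eq_iff matrix_matrix_mult_def mult.commute)

lemma ctrans_ctrans [simp]: "ctrans (ctrans A) = A"
  by (simp add: vec_eq_iff)

lemma ctrans_minus: "ctrans (- A) = - ctrans A"
  by (simp add: vec_eq_iff)

lemma ctrans_mat_1 [simp]: "ctrans (mat 1) = mat 1"
  by (simp add: vec_eq_iff mat_def)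

lemma
  fixes A :: "'n::finite cmat"
  assumes "invertible A"
  shows matrix_inv_right: "A ** matrix_inv A = mat 1"
    and matrix_inv_left: "matrix_inv A ** A = mat 1"
  using someI_ex[OF assms[unfolded invertible_def]] by (auto simp: matrix_inv_def)

lemma right_inverse_imp_matrix_inv:
  fixes A B :: "'n::finite cmat"
  assumes "A ** B = mat 1"
  shows "invertible A" and "matrix_inv A = B"
proof -
  have BA: "B ** A = mat 1" using assms by (simp add: matrix_left_right_inverse)
  thus inv: "invertible A" using assms by (auto simp: invertible_def)
  have "matrix_inv A = (B ** A) ** matrix_inv A" by (simp add: BA)
  also have "\<dots> = B" by (simp add: matrix_inv_right[OF inv] flip: matrix_mul_assoc)
  finally show "matrix_inv A = B" .
qed

lemma invertible_mat_1: "invertible (mat 1 :: 'n::finite cmat)"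
  and matrix_inv_mat_1: "matrix_inv (mat 1 :: 'n::finite cmat) = mat 1"
  using right_inverse_imp_matrix_inv[of "mat 1 :: 'n cmat" "mat 1"] by simp_all

lemma ctrans_scaleR: "ctrans (c *\<^sub>R A) = c *\<^sub>R ctrans A"
  by (simp add: vec_eq_iff)

lemma matrix_mult_diff_left: "((A :: 'n::finite cmat) - B) ** C = A ** C - B ** (C :: 'n cmat)"
  by (simp add: vec_eq_iff matrix_matrix_mult_def sum_subtractf left_diff_distrib)

lemma matrix_mult_diff_right: "C ** (A - B) = C ** A - C ** (B :: 'n::finite cmat)"
  by (simp add: vec_eq_iff matrix_matrix_mult_def sum_subtractf right_diff_distrib)

lemma matrix_mult_scaleR_left: "(c *\<^sub>R A) ** B = c *\<^sub>R ((A :: 'n::finite cmat) ** (B :: 'n cmat))"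
  by (simp only: cscale_of_real[symmetric] cscale_mult_left)

lemma matrix_mult_scaleR_right: "A ** (c *\<^sub>R B) = c *\<^sub>R ((A :: 'n::finite cmat) ** (B :: 'n cmat))"
  by (simp only: cscale_of_real[symmetric] cscale_mult_right)

lemma matrix_mult_add_right: "C ** (A + B) = C ** A + C ** (B :: 'n::finite cmat)"
  by (rule matrix_add_ldistrib)

lemma matrix_mult_add_left: "((A :: 'n::finite cmat) + B) ** C = A ** C + B ** (C :: 'n cmat)"
  by (simp add: vec_eq_iff matrix_matrix_mult_def sum.distrib distrib_right)

lemma bounded_bilinear_matrix_mult:
  "bounded_bilinear (\<lambda>(A :: 'n::finite cmat) (B :: 'n cmat). A ** B)"
  unfolding bilinear_conv_bounded_bilinear[symmetric]
  by (auto simp: bilinear_def matrix_mult_add_left matrix_mult_add_right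
      matrix_mult_scaleR_left matrix_mult_scaleR_right intro!: linearI)

lemmas matrix_mult_zero =
  bounded_bilinear.zero_left[OF bounded_bilinear_matrix_mult]
  bounded_bilinear.zero_right[OF bounded_bilinear_matrix_mult]

lemma bounded_bilinear_matrix_vector:
  "bounded_bilinear (\<lambda>(A :: 'n::finite cmat) v. A *v v)"
  unfolding bilinear_conv_bounded_bilinear[symmetric] bilinear_def
proof (intro conjI allI linearI)
  fix A :: "'n cmat" and r :: real and v :: "complex^'n"
  show "(r *\<^sub>R A) *v v = r *\<^sub>R (A *v v)"
    by (simp add: vec_eq_iff matrix_vector_mult_def scaleR_sum_right)
  show "A *v (r *\<^sub>R v) = r *\<^sub>R (A *v v)"
    by (simp add: vec_eq_iff matrix_vector_mult_def scaleR_sum_right)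
qed (auto simp: algebra_simps)

lemma bounded_linear_ctrans: "bounded_linear (ctrans :: 'n::finite cmat \<Rightarrow> 'n cmat)"
  unfolding linear_conv_bounded_linear[symmetric]
  by (intro linearI) (auto simp: vec_eq_iff)

lemma bounded_linear_matrix_nth: "bounded_linear (\<lambda>A :: 'n::finite cmat. A $ i $ j)"
  using bounded_linear_compose[OF bounded_linear_vec_nth bounded_linear_vec_nth] .

lemma bounded_linear_cscale: "bounded_linear (\<lambda>A :: 'n::finite cmat. cscale c A)"
  unfolding linear_conv_bounded_linear[symmetric]
  by (intro linearI) (auto simp: vec_eq_iff algebra_simps)

lemma norm_vec_power2: "(norm (x :: ('a::real_normed_vector)^'n::finite))\<^sup>2 = (\<Sum>i\<in>UNIV. (norm (x $ i))\<^sup>2)"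
  by (simp add: norm_vec_def L2_set_def sum_nonneg)

lemma norm_cscale [simp]: "norm (cscale c (A :: 'n::finite cmat)) = cmod c * norm A"
proof (rule power2_eq_imp_eq)
  show "(norm (cscale c A))\<^sup>2 = (cmod c * norm A)\<^sup>2"
    by (simp add: norm_vec_power2 norm_mult power_mult_distrib sum_distrib_left)
qed auto

text \<open>The Euclidean norm of a matrix, as an element of the space of matrices, is its Frobenius
  norm; submultiplicativity is the Cauchy-Schwarz inequality applied to each entry.\<close>

lemma norm_matrix_mult_le: "norm (A ** B) \<le> norm A * norm (B :: 'n::finite cmat)"
proof (rule power2_le_imp_le)
  have entry: "(cmod ((A ** B) $ i $ j))\<^sup>2 \<le> (\<Sum>k\<in>UNIV. (cmod (A $ i $ k))\<^sup>2) * (\<Sum>k\<in>UNIV. (cmod (B $ k $ j))\<^sup>2)"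
    for i j
  proof -
    have "cmod ((A ** B) $ i $ j) \<le> (\<Sum>k\<in>UNIV. cmod (A $ i $ k) * cmod (B $ k $ j))"
      by (simp add: matrix_matrix_mult_def) (rule order_trans[OF norm_sum], simp add: norm_mult)
    hence "(cmod ((A ** B) $ i $ j))\<^sup>2 \<le> (\<Sum>k\<in>UNIV. cmod (A $ i $ k) * cmod (B $ k $ j))\<^sup>2"
      by (intro power_mono) auto
    also have "\<dots> \<le> (\<Sum>k\<in>UNIV. (cmod (A $ i $ k))\<^sup>2) * (\<Sum>k\<in>UNIV. (cmod (B $ k $ j))\<^sup>2)"
      by (rule Cauchy_Schwarz_ineq_sum)
    finally show ?thesis .
  qed
  have "(norm (A ** B))\<^sup>2 = (\<Sum>i\<in>UNIV. \<Sum>j\<in>UNIV. (cmod ((A ** B) $ i $ j))\<^sup>2)"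
    by (simp add: norm_vec_power2)
  also have "\<dots> \<le> (\<Sum>i\<in>UNIV. \<Sum>j\<in>UNIV. (\<Sum>k\<in>UNIV. (cmod (A $ i $ k))\<^sup>2) * (\<Sum>k\<in>UNIV. (cmod (B $ k $ j))\<^sup>2))"
    by (intro sum_mono entry)
  also have "\<dots> = (\<Sum>i\<in>UNIV. \<Sum>k\<in>UNIV. (cmod (A $ i $ k))\<^sup>2) * (\<Sum>j\<in>UNIV. \<Sum>k\<in>UNIV. (cmod (B $ k $ j))\<^sup>2)"
    by (simp add: sum_product)
  also have "(\<Sum>j\<in>UNIV. \<Sum>k\<in>UNIV. (cmod (B $ k $ j))\<^sup>2) = (\<Sum>k\<in>UNIV. \<Sum>j\<in>UNIV. (cmod (B $ k $ j))\<^sup>2)"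
    by (rule sum.swap)
  also have "(\<Sum>i\<in>UNIV. \<Sum>k\<in>UNIV. (cmod (A $ i $ k))\<^sup>2) * \<dots> = (norm A * norm B)\<^sup>2"
    by (simp add: norm_vec_power2 power_mult_distrib)
  finally show "(norm (A ** B))\<^sup>2 \<le> (norm A * norm B)\<^sup>2" .
qed auto

lemma norm_ctrans [simp]: "norm (ctrans (A :: 'n::finite cmat)) = norm A"
proof (rule power2_eq_imp_eq)
  have "(norm (ctrans A))\<^sup>2 = (\<Sum>i\<in>UNIV. \<Sum>j\<in>UNIV. (cmod (A $ j $ i))\<^sup>2)"
    by (simp add: norm_vec_power2)
  also have "\<dots> = (norm A)\<^sup>2"
    by (subst sum.swap) (simp add: norm_vec_power2)
  finally show "(norm (ctrans A))\<^sup>2 = (norm A)\<^sup>2" .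
qed auto

lemma norm_mat_1: "norm (mat 1 :: 'n::finite cmat) = sqrt (real CARD('n))"
proof -
  have "(norm (mat 1 :: 'n cmat))\<^sup>2 = (\<Sum>i\<in>(UNIV :: 'n set). \<Sum>j\<in>(UNIV :: 'n set). if i = j then 1 else 0)"
    unfolding norm_vec_power2 by (intro sum.cong refl) (auto simp: mat_def)
  also have "\<dots> = real CARD('n)" by simp
  finally show ?thesis by (metis norm_ge_zero real_sqrt_unique)
qed

lemma star_matrix_norm_norm: "star_matrix_norm (norm :: 'n::finite cmat \<Rightarrow> real)"
  by (auto simp: star_matrix_norm_def norm_triangle_ineq norm_matrix_mult_le)

definition unit_matrix :: "'n::finite \<Rightarrow> 'n \<Rightarrow> 'n cmat" where
  "unit_matrix i j = (\<chi> k l. if k = i \<and> l = j then 1 else 0)"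

lemma unit_matrix_nth [simp]: "unit_matrix i j $ k $ l = (if k = i \<and> l = j then 1 else 0)"
  by (simp add: unit_matrix_def)

lemma matrix_eq_sum_unit: "A = (\<Sum>i\<in>UNIV. \<Sum>j\<in>UNIV. cscale (A $ i $ j) (unit_matrix i j))"
proof -
  have "(\<Sum>i\<in>UNIV. \<Sum>j\<in>UNIV. A $ i $ j * (if k = i \<and> l = j then 1 else 0)) = A $ k $ l" for k l
  proof -
    have "(\<Sum>i\<in>UNIV. \<Sum>j\<in>UNIV. A $ i $ j * (if k = i \<and> l = j then 1 else 0))
        = (\<Sum>i\<in>UNIV. if k = i then (\<Sum>j\<in>UNIV. if l = j then A $ i $ j else 0) else 0)"
      by (intro sum.cong refl) (simp add: if_distrib[of "\<lambda>x. _ * x"] cong: if_cong)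
    thus ?thesis by (simp only: sum.delta' finite UNIV_I if_True)
  qed
  thus ?thesis by (simp add: vec_eq_iff)
qed

section \<open>Submultiplicative matrix norms\<close>

locale star_norm =
  fixes N :: "'n::finite cmat \<Rightarrow> real"
  assumes star_matrix_norm: "star_matrix_norm N"
begin

lemma
  shows N_eq_0: "N A = 0 \<longleftrightarrow> A = 0"
    and N_triangle: "N (A + B) \<le> N A + N B"
    and N_cscale: "N (cscale c A) = cmod c * N A"
    and N_mult: "N (A ** B) \<le> N A * N B"
    and N_ctrans: "N (ctrans A) = N A"
  using star_matrix_norm by (auto simp: star_matrix_norm_def)

lemma N_0 [simp]: "N 0 = 0"
  by (simp add: N_eq_0)

lemma N_scaleR: "N (c *\<^sub>R A) = \<bar>c\<bar> * N A"
  by (metis N_cscale cscale_of_real norm_of_real)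

lemma N_minus [simp]: "N (- A) = N A"
  using N_scaleR[of "-1" A] by simp

lemma N_nonneg [simp]: "0 \<le> N A"
  using N_triangle[of A "- A"] by simp

lemma N_sum: "N (\<Sum>i\<in>S. F i) \<le> (\<Sum>i\<in>S. N (F i))"
proof (induction S rule: infinite_finite_induct)
  case (insert x S)
  thus ?case using N_triangle[of "F x" "sum F S"] by simp
qed auto

lemma N_mat_1_ge: "1 \<le> N (mat 1)"
proof -
  have "(mat 1 :: 'n cmat) $ i $ i \<noteq> 0 $ i $ i" for i by (simp add: mat_def)
  hence "N (mat 1) \<noteq> 0" unfolding N_eq_0 by metis
  moreover have "N (mat 1) \<le> N (mat 1) * N (mat 1)"
    using N_mult[of "mat 1" "mat 1"] by simp
  ultimately show ?thesis
    using N_nonneg[of "mat 1"] by (auto simp: mult_le_cancel_left1)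
qed

lemma N_le_norm: "N A \<le> (\<Sum>i\<in>UNIV. \<Sum>j\<in>UNIV. N (unit_matrix i j)) * norm A"
proof -
  have "N A \<le> (\<Sum>i\<in>UNIV. \<Sum>j\<in>UNIV. N (cscale (A $ i $ j) (unit_matrix i j)))"
    by (subst matrix_eq_sum_unit) (intro order_trans[OF N_sum] sum_mono N_sum)
  also have "\<dots> \<le> (\<Sum>i\<in>UNIV. \<Sum>j\<in>UNIV. N (unit_matrix i j) * norm A)"
    unfolding N_cscale
    by (intro sum_mono, subst mult.commute, intro mult_left_mono)
       (auto intro: order_trans[OF Finite_Cartesian_Product.norm_nth_le Finite_Cartesian_Product.norm_nth_le])
  finally show ?thesis by (simp add: sum_distrib_right)
qed

text \<open>Multiplying by matrix units on both sides isolates a single entry, so submultiplicativity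
  bounds the entries by \<open>N\<close>; in this way \<open>N\<close> dominates the Euclidean norm without an appeal
  to compactness.\<close>

lemma norm_le_N: "\<exists>B>0. \<forall>A. norm A \<le> B * N A"
proof -
  define c where "c = (\<lambda>i j. N (unit_matrix i i) * N (unit_matrix j j) / N (unit_matrix i j))"
  have pos: "0 < N (unit_matrix i j)" for i j
  proof -
    have "unit_matrix i j $ i $ j \<noteq> 0 $ i $ j" by simp
    hence "unit_matrix i j \<noteq> 0" by metis
    thus ?thesis using N_eq_0 N_nonneg by (metis order_le_less)
  qed
  have entry: "cmod (A $ i $ j) \<le> c i j * N A" for A i j
  proof -
    have "unit_matrix i i ** A ** unit_matrix j j = cscale (A $ i $ j) (unit_matrix i j)"
    proof -
      have "(unit_matrix i i ** A ** unit_matrix j j) $ k $ l = cscale (A $ i $ j) (unit_matrix i j) $ k $ l" for k l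
      proof -
        have row: "(unit_matrix i i ** A) $ k $ q = (if k = i then A $ i $ q else 0)" for q
        proof -
          have "(unit_matrix i i ** A) $ k $ q = (\<Sum>p\<in>UNIV. unit_matrix i i $ k $ p * A $ p $ q)"
            by (simp add: matrix_matrix_mult_def del: unit_matrix_nth)
          also have "\<dots> = (\<Sum>p\<in>UNIV. if p = i then (if k = i then A $ p $ q else 0) else 0)"
            by (intro sum.cong refl) auto
          finally have "(unit_matrix i i ** A) $ k $ q = \<dots>" .
          thus ?thesis by simp
        qed
        have "(unit_matrix i i ** A ** unit_matrix j j) $ k $ l
            = (\<Sum>q\<in>UNIV. (unit_matrix i i ** A) $ k $ q * unit_matrix j j $ q $ l)"
          by (simp add: matrix_matrix_mult_def del: unit_matrix_nth)
        also have "\<dots> = (\<Sum>q\<in>UNIV. if q = j then (if k = i \<and> l = j then A $ i $ q else 0) else 0)"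
          unfolding row by (intro sum.cong refl) auto
        finally show ?thesis by simp
      qed
      thus ?thesis by (simp add: vec_eq_iff)
    qed
    hence "cmod (A $ i $ j) * N (unit_matrix i j) = N (unit_matrix i i ** A ** unit_matrix j j)"
      by (simp add: N_cscale)
    also have "\<dots> \<le> N (unit_matrix i i ** A) * N (unit_matrix j j)"
      by (rule N_mult)
    also have "\<dots> \<le> N (unit_matrix i i) * N A * N (unit_matrix j j)"
      by (intro mult_right_mono N_mult N_nonneg)
    finally have "cmod (A $ i $ j) * N (unit_matrix i j) \<le> \<dots>" .
    thus ?thesis using pos[of i j] by (simp add: c_def field_simps)
  qed
  have c0: "0 \<le> c i j" for i j by (simp add: c_def)
  have "norm A \<le> (1 + (\<Sum>i\<in>UNIV. \<Sum>j\<in>UNIV. c i j)) * N A" for A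
  proof -
    have "norm A \<le> (\<Sum>i\<in>UNIV. norm (A $ i))"
      unfolding norm_vec_def by (rule L2_set_le_sum) auto
    also have "\<dots> \<le> (\<Sum>i\<in>UNIV. \<Sum>j\<in>UNIV. cmod (A $ i $ j))"
      unfolding norm_vec_def[of "_ $ _"] by (intro sum_mono L2_set_le_sum) auto
    also have "\<dots> \<le> (\<Sum>i\<in>UNIV. \<Sum>j\<in>UNIV. c i j * N A)"
      by (intro sum_mono entry)
    also have "\<dots> \<le> (1 + (\<Sum>i\<in>UNIV. \<Sum>j\<in>UNIV. c i j)) * N A"
      by (simp add: sum_distrib_right distrib_right)
    finally show ?thesis .
  qed
  moreover have "0 < 1 + (\<Sum>i\<in>UNIV. \<Sum>j\<in>UNIV. c i j)"
    by (intro add_pos_nonneg sum_nonneg c0) auto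
  ultimately show ?thesis by blast
qed

lemma continuous_on_N: "continuous_on UNIV N"
proof -
  define L where "L = (\<Sum>i\<in>UNIV. \<Sum>j\<in>UNIV. N (unit_matrix i j))"
  have L: "0 \<le> L" unfolding L_def by (intro sum_nonneg) auto
  have "\<bar>N A - N B\<bar> \<le> L * norm (A - B)" for A B
  proof -
    have "\<bar>N A - N B\<bar> \<le> N (A - B)"
      using N_triangle[of "A - B" B] N_triangle[of "B - A" A] N_minus[of "A - B"] by simp
    thus ?thesis using N_le_norm[of "A - B"] by (simp add: L_def)
  qed
  hence "L-lipschitz_on UNIV N"
    by (intro lipschitz_onI) (auto simp: dist_norm L)
  thus ?thesis by (rule lipschitz_on_continuous_on)
qed

text \<open>A mean value inequality for an arbitrary norm: were it false, a hyperplane would separate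
  the increment of \<open>h\<close> from the ball of radius \<open>m b - m a\<close>, and the functional defining the
  hyperplane would violate the mean value theorem for real functions.\<close>

lemma mean_value_inequality:
  fixes h :: "real \<Rightarrow> 'n cmat" and m :: "real \<Rightarrow> real"
  assumes ab: "a < b"
    and h: "\<And>t. t \<in> {a..b} \<Longrightarrow> (h has_vector_derivative h' t) (at t within {a..b})"
    and m: "\<And>t. t \<in> {a..b} \<Longrightarrow> (m has_vector_derivative m' t) (at t within {a..b})"
    and le: "\<And>t. t \<in> {a..b} \<Longrightarrow> N (h' t) \<le> m' t"
    and pos: "\<And>t. t \<in> {a..b} \<Longrightarrow> 0 < m' t"
  shows "N (h b - h a) \<le> m b - m a"
proof (rule ccontr)
  assume contra: "\<not> ?thesis"
  define c where "c = m b - m a"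
  define S where "S = {A. N A \<le> c}"
  have "\<exists>x\<in>{a<..<b}. m b - m a = (b - a) * m' x"
    using ab m by (intro mvt_simple[of a b m "\<lambda>t s. s * m' t"])
                  (auto simp: has_vector_derivative_def)
  then obtain x where "x \<in> {a<..<b}" "m b - m a = (b - a) * m' x" by blast
  hence c: "0 < c" using ab pos[of x] by (simp add: c_def)
  have "convex S"
    unfolding convex_def S_def
  proof (intro ballI allI impI)
    fix A B and u v :: real
    assume AB: "A \<in> {A. N A \<le> c}" "B \<in> {A. N A \<le> c}" and uv: "0 \<le> u" "0 \<le> v" "u + v = 1"
    have "N (u *\<^sub>R A + v *\<^sub>R B) \<le> u * N A + v * N B"
      using N_triangle[of "u *\<^sub>R A" "v *\<^sub>R B"] uv by (simp add: N_scaleR)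
    also have "\<dots> \<le> u * c + v * c"
      using AB uv by (intro add_mono mult_left_mono) auto
    finally show "u *\<^sub>R A + v *\<^sub>R B \<in> {A. N A \<le> c}"
      using uv by (simp flip: distrib_right)
  qed
  moreover have "closed S"
    unfolding S_def by (intro closed_Collect_le continuous_on_N continuous_on_const)
  moreover have "h b - h a \<notin> S" using contra by (simp add: S_def c_def)
  ultimately obtain w d where w: "inner w (h b - h a) < d" and d: "\<And>A. A \<in> S \<Longrightarrow> d < inner w A"
    using separating_hyperplane_closed_point[of S "h b - h a"] by blast
  \<comment> \<open>The derivative values lie in scaled copies of the ball.\<close>
  have deriv_ge: "d / c * m' t \<le> inner w (h' t)" if t: "t \<in> {a..b}" for t
  proof -
    have mt: "0 < m' t" using pos[OF t] .
    have "(c / m' t) *\<^sub>R h' t \<in> S"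
      using le[OF t] mt c by (simp add: S_def N_scaleR field_simps)
    from d[OF this] show ?thesis using mt c by (simp add: field_simps)
  qed
  have "\<exists>x\<in>{a<..<b}. (inner w (h b) - d / c * m b) - (inner w (h a) - d / c * m a)
      = (b - a) * (inner w (h' x) - d / c * m' x)"
  proof (intro mvt_simple[of a b "\<lambda>t. inner w (h t) - d / c * m t"
        "\<lambda>t s. s * (inner w (h' t) - d / c * m' t)"])
    fix t assume t: "a \<le> t" "t \<le> b"
    have "((\<lambda>t. inner w (h t) - d / c * m t) has_vector_derivative (inner w (h' t) - d / c * m' t))
        (at t within {a..b})"
      using h[of t] m[of t] t
      by (auto intro!: derivative_intros bounded_linear.has_vector_derivative[OF bounded_linear_inner_right]
          bounded_linear.has_vector_derivative[OF bounded_linear_mult_right])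
    thus "((\<lambda>t. inner w (h t) - d / c * m t) has_derivative (\<lambda>s. s * (inner w (h' t) - d / c * m' t)))
        (at t within {a..b})"
      by (simp add: has_vector_derivative_def)
  qed (use ab in auto)
  then obtain x where x: "x \<in> {a<..<b}"
    and eq: "(inner w (h b) - d / c * m b) - (inner w (h a) - d / c * m a)
      = (b - a) * (inner w (h' x) - d / c * m' x)" by blast
  have "0 \<le> (b - a) * (inner w (h' x) - d / c * m' x)"
    using ab x deriv_ge[of x] by auto
  hence "d / c * (m b - m a) \<le> inner w (h b - h a)"
    using eq by (simp add: inner_diff_right right_diff_distrib)
  thus False using w c by (simp add: c_def)
qed

end

section \<open>The scaled Catalan numbers\<close>

lemma fnum_nonneg: "0 \<le> a \<Longrightarrow> 0 \<le> fnum a n"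
proof (induction n rule: less_induct)
  case (less n)
  thus ?case by (cases n) (auto intro!: mult_nonneg_nonneg sum_nonneg)
qed

lemma fnum_mono: "0 \<le> a \<Longrightarrow> a \<le> b \<Longrightarrow> fnum a n \<le> fnum b n"
proof (induction n rule: less_induct)
  case (less n)
  thus ?case
    by (cases n) (auto intro!: mult_mono sum_mono sum_nonneg mult_nonneg_nonneg fnum_nonneg)
qed

lemma fnum_le_Suc:
  assumes "1 \<le> a"
  shows "fnum a n \<le> fnum a (Suc n)"
proof -
  have "fnum a n = fnum a (n - 0) * fnum a 0" by simp
  also have "\<dots> \<le> (\<Sum>j\<le>n. fnum a (n - j) * fnum a j)"
    using assms by (intro member_le_sum) (auto intro!: mult_nonneg_nonneg fnum_nonneg)
  also have "\<dots> \<le> a * \<dots>"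
    using assms by (intro mult_right_mono[of 1 a, simplified]) (auto intro!: sum_nonneg mult_nonneg_nonneg fnum_nonneg)
  finally show ?thesis by simp
qed

lemma fnum_ge_1: "1 \<le> a \<Longrightarrow> 1 \<le> fnum a n"
  by (induction n) (auto intro: order_trans[OF _ fnum_le_Suc] simp del: fnum.simps(2))

lemma convolution_sum_le_square:
  fixes u :: "nat \<Rightarrow> real"
  assumes "\<And>k. 0 \<le> u k"
  shows "(\<Sum>k\<le>n. \<Sum>j\<le>k. u j * u (k - j)) \<le> (\<Sum>k\<le>n. u k)\<^sup>2"
proof -
  have "(\<Sum>k\<le>n. \<Sum>j\<le>k. u j * u (k - j)) = (\<Sum>(i, j)\<in>{(i, j). i + j \<le> n}. u i * u j)"
    by (rule sum.triangle_reindex_eq[symmetric])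
  also have "\<dots> \<le> (\<Sum>(i, j)\<in>{..n} \<times> {..n}. u i * u j)"
    using assms by (intro sum_mono2) auto
  also have "\<dots> = (\<Sum>k\<le>n. u k)\<^sup>2"
    by (simp add: power2_eq_square sum_product sum.cartesian_product)
  finally show ?thesis .
qed

text \<open>The generating function \<open>P(x)\<close> of the numbers satisfies \<open>P = 1 + a x P\<^sup>2\<close>. At
  \<open>x = 1/(4 a)\<close> the value \<open>2\<close> is the fixed point of \<open>P \<mapsto> 1 + P\<^sup>2/4\<close>, so it bounds the partial sums by
  induction, hence also their single terms.\<close>

lemma fnum_le_power:
  assumes a: "0 < a"
  shows "fnum a n \<le> 2 * (4 * a) ^ n"
proof -
  define u where "u = (\<lambda>k. fnum a k * (1 / (4 * a)) ^ k)"
  have u0: "0 \<le> u k" for k using a fnum_nonneg[of a k] by (simp add: u_def)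
  have uSuc: "u (Suc k) = 1 / 4 * (\<Sum>j\<le>k. u j * u (k - j))" for k
  proof -
    have "u (Suc k) = 1 / 4 * ((\<Sum>j\<le>k. fnum a (k - j) * fnum a j) * (1 / (4 * a)) ^ k)"
      using a by (simp add: u_def)
    also have "(\<Sum>j\<le>k. fnum a (k - j) * fnum a j) * (1 / (4 * a)) ^ k = (\<Sum>j\<le>k. u j * u (k - j))"
      unfolding sum_distrib_right
    proof (intro sum.cong refl)
      fix j assume "j \<in> {..k}"
      hence "(1 / (4 * a)) ^ k = (1 / (4 * a)) ^ j * (1 / (4 * a)) ^ (k - j)"
        by (simp flip: power_add)
      thus "fnum a (k - j) * fnum a j * (1 / (4 * a)) ^ k = u j * u (k - j)"
        by (simp add: u_def)
    qed
    finally show ?thesis .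
  qed
  have P: "(\<Sum>k\<le>n. u k) \<le> 2" for n
  proof (induction n)
    case (Suc n)
    have "(\<Sum>k\<le>Suc n. u k) = u 0 + (\<Sum>k\<le>n. u (Suc k))"
      by (rule sum.atMost_Suc_shift)
    also have "\<dots> = 1 + 1 / 4 * (\<Sum>k\<le>n. \<Sum>j\<le>k. u j * u (k - j))"
      unfolding uSuc by (simp add: u_def sum_distrib_left)
    also have "\<dots> \<le> 1 + 1 / 4 * (\<Sum>k\<le>n. u k)\<^sup>2"
      using convolution_sum_le_square[of u n] u0 by simp
    also have "\<dots> \<le> 1 + 1 / 4 * 2\<^sup>2"
      using Suc by (intro add_left_mono mult_left_mono power_mono sum_nonneg u0) auto
    finally show ?case by simp
  qed (simp add: u_def)
  have "u n \<le> (\<Sum>k\<le>n. u k)"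
    by (intro member_le_sum) (auto intro: u0)
  hence "u n \<le> 2" using P[of n] by simp
  thus ?thesis using a by (simp add: u_def power_divide field_simps)
qed

section \<open>Sequences of successive derivatives\<close>

definition jet_on :: "real set \<Rightarrow> (nat \<Rightarrow> real \<Rightarrow> 'a::real_normed_vector) \<Rightarrow> bool" where
  "jet_on X F \<longleftrightarrow> (\<forall>k. \<forall>t\<in>X. (F k has_vector_derivative F (Suc k) t) (at t within X))"

lemma jet_onD: "jet_on X F \<Longrightarrow> t \<in> X \<Longrightarrow> (F k has_vector_derivative F (Suc k) t) (at t within X)"
  by (auto simp: jet_on_def)

lemma nderiv_0 [simp]: "nderiv X 0 f = f"
  by (simp add: nderiv_def)

lemma nderiv_Suc: "nderiv X (Suc k) f t = vector_derivative (nderiv X k f) (at t within X)"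
  by (simp add: nderiv_def)

lemma jet_on_nderiv: "smooth_within X f \<Longrightarrow> jet_on X (\<lambda>k. nderiv X k f)"
  by (simp add: jet_on_def smooth_within_def nderiv_Suc vector_derivative_works)

lemma jet_on_subset: "jet_on X F \<Longrightarrow> Y \<subseteq> X \<Longrightarrow> jet_on Y F"
  by (meson jet_on_def has_vector_derivative_within_subset subsetD)

lemma jet_on_Suc: "jet_on X F \<Longrightarrow> jet_on X (\<lambda>k. F (Suc k))"
  by (simp add: jet_on_def)

lemma jet_on_sum: "(\<And>i. i \<in> S \<Longrightarrow> jet_on X (F i)) \<Longrightarrow> jet_on X (\<lambda>k t. \<Sum>i\<in>S. F i k t)"
  by (auto simp: jet_on_def intro!: has_vector_derivative_sum)

lemma jet_on_bounded_linear: "bounded_linear L \<Longrightarrow> jet_on X F \<Longrightarrow> jet_on X (\<lambda>k t. L (F k t))"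
  unfolding jet_on_def using bounded_linear.has_vector_derivative[of L] by blast

lemma at_within_interval_neq_bot:
  fixes a b :: real
  assumes "a < b" "t \<in> {a..b}"
  shows "at t within {a..b} \<noteq> bot"
  using assms by (simp add: trivial_limit_within islimpt_Icc)

lemma jet_on_unique:
  fixes a b :: real
  assumes "a < b" and F: "jet_on {a..b} F" and G: "jet_on {a..b} G"
    and eq: "\<And>t. t \<in> {a..b} \<Longrightarrow> F 0 t = G 0 t"
  shows "t \<in> {a..b} \<Longrightarrow> F k t = G k t"
proof (induction k arbitrary: t)
  case (Suc k)
  have "(F k has_vector_derivative G (Suc k) t) (at t within {a..b})"
    using Suc by (intro has_vector_derivative_transform[OF _ _ jet_onD[OF G]]) auto
  with jet_onD[OF F Suc.prems] show ?case
    by (rule vector_derivative_unique_within[OF at_within_interval_neq_bot[OF \<open>a < b\<close> Suc.prems]])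
qed (use eq in auto)

lemma nderiv_jet:
  fixes a b :: real
  assumes "a < b" and F: "jet_on {a..b} F" and eq: "\<And>t. t \<in> {a..b} \<Longrightarrow> f t = F 0 t"
  shows "t \<in> {a..b} \<Longrightarrow> nderiv {a..b} k f t = F k t"
proof (induction k arbitrary: t)
  case (Suc k)
  have "(nderiv {a..b} k f has_vector_derivative F (Suc k) t) (at t within {a..b})"
    using Suc by (intro has_vector_derivative_transform[OF _ _ jet_onD[OF F]]) auto
  thus ?case
    unfolding nderiv_Suc
    by (rule vector_derivative_within[OF at_within_interval_neq_bot[OF \<open>a < b\<close> Suc.prems]])
qed (use eq in auto)

lemma smooth_within_jet:
  fixes a b :: real
  assumes "a < b" and F: "jet_on {a..b} F" and eq: "\<And>t. t \<in> {a..b} \<Longrightarrow> f t = F 0 t"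
  shows "smooth_within {a..b} f"
  unfolding smooth_within_def
proof (intro allI ballI)
  fix k t assume t: "t \<in> {a..b}"
  have "(nderiv {a..b} k f has_vector_derivative F (Suc k) t) (at t within {a..b})"
    using t nderiv_jet[OF assms] by (intro has_vector_derivative_transform[OF _ _ jet_onD[OF F]]) auto
  thus "nderiv {a..b} k f differentiable at t within {a..b}"
    by (metis differentiableI_vector)
qed

text \<open>For jets \<open>a\<close> and \<open>b\<close> of two functions and a product \<open>P\<close>, this is the \<open>k\<close>-th derivative of the
  product of the \<open>i\<close>-th derivative of the first with the \<open>j\<close>-th derivative of the second. Unfolding
  the product rule as a recursion dispenses with binomial coefficients: majorization of products
  is an immediate induction.\<close>

fun leibniz :: "('a \<Rightarrow> 'b \<Rightarrow> 'c::plus) \<Rightarrow> (nat \<Rightarrow> 'a) \<Rightarrow> (nat \<Rightarrow> 'b) \<Rightarrow> nat \<Rightarrow> nat \<Rightarrow> nat \<Rightarrow> 'c" where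
  "leibniz P a b 0 i j = P (a i) (b j)"
| "leibniz P a b (Suc k) i j = leibniz P a b k (Suc i) j + leibniz P a b k i (Suc j)"

lemma jet_on_leibniz:
  assumes P: "bounded_bilinear P" and a: "jet_on X a" and b: "jet_on X b"
  shows "jet_on X (\<lambda>k t. leibniz P (\<lambda>m. a m t) (\<lambda>m. b m t) k i j)"
proof -
  have "((\<lambda>t. leibniz P (\<lambda>m. a m t) (\<lambda>m. b m t) k i j) has_vector_derivative
      leibniz P (\<lambda>m. a m t) (\<lambda>m. b m t) (Suc k) i j) (at t within X)" if t: "t \<in> X" for k t
  proof (induction k arbitrary: i j)
    case 0
    show ?case
      using bounded_bilinear.has_vector_derivative[OF P jet_onD[OF a t, of i] jet_onD[OF b t, of j]]
      by (simp add: add.commute)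
  next
    case (Suc k)
    show ?case
      using has_vector_derivative_add[OF Suc[of "Suc i" j] Suc[of i "Suc j"]] by simp
  qed
  thus ?thesis by (simp add: jet_on_def)
qed

lemma leibniz_majorant:
  fixes N :: "'c::plus \<Rightarrow> real"
  assumes "\<And>x y. N (x + y) \<le> N x + N y" and "\<And>x y. N (P x y) \<le> N1 x * N2 y"
    and "\<And>x. 0 \<le> N1 x" and "\<And>y. 0 \<le> N2 y"
    and "\<And>i. N1 (a i) \<le> \<alpha> i" and "\<And>j. N2 (b j) \<le> \<beta> j"
  shows "N (leibniz P a b k i j) \<le> leibniz (*) \<alpha> \<beta> k i j"
proof (induction k arbitrary: i j)
  case 0
  have "N1 (a i) * N2 (b j) \<le> \<alpha> i * \<beta> j"
    using assms(3-6) by (intro mult_mono) (auto intro: order_trans)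
  thus ?case using assms(2)[of "a i" "b j"] by simp
next
  case (Suc k)
  show ?case
    using assms(1)[of "leibniz P a b k (Suc i) j" "leibniz P a b k i (Suc j)"]
      Suc[of "Suc i" j] Suc[of i "Suc j"] by simp
qed

lemma leibniz_scale:
  fixes \<alpha> \<beta> :: "nat \<Rightarrow> real"
  shows "leibniz (*) \<alpha> (\<lambda>m. c * \<beta> m) k i j = c * leibniz (*) \<alpha> \<beta> k i j"
  by (induction k arbitrary: i j) (auto simp: algebra_simps)

section \<open>The majorant of the moments\<close>

locale majorized_moments =
  fixes I :: "real set" and t0 T C :: real
    and \<sigma>1 \<sigma>2 \<gamma> \<gamma>s :: "real \<Rightarrow> 'n::finite cmat"
    and H :: "nat \<Rightarrow> real \<Rightarrow> 'n cmat"
    and K :: "nat \<Rightarrow> real \<Rightarrow> 'n cmat \<Rightarrow>\<^sub>L 'n cmat"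
    and N :: "'n cmat \<Rightarrow> real" and NK :: "('n cmat \<Rightarrow>\<^sub>L 'n cmat) \<Rightarrow> real" and M :: "real \<Rightarrow> real"
  assumes majorized: "majorized_vessel I t0 T \<sigma>1 \<sigma>2 \<gamma> \<gamma>s H K N NK C M"
begin

sublocale star_norm N
  using majorized by unfold_locales (simp add: majorized_vessel_def Let_def)

abbreviation "J \<equiv> {t0..T}"

abbreviation "r \<equiv> size_factor N (\<sigma>1 t0)"

lemma
  shows t0_less_T: "t0 < T" and J_subset: "J \<subseteq> I"
    and vessel: "vessel_parameters I \<sigma>1 \<sigma>2 \<gamma> \<gamma>s"
    and moments: "vessel_moments I \<sigma>1 \<sigma>2 \<gamma> \<gamma>s H"
    and smooth_H: "smooth_within I (H n)"
    and coefficients: "moment_coefficients I H K"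
    and smooth_K: "i \<le> 3 \<Longrightarrow> smooth_within I (K i)"
    and NK: "consistent_norm N NK"
    and smooth_NK: "i \<le> 3 \<Longrightarrow> smooth_within J (\<lambda>t. NK (K i t))"
    and NK_nderiv: "i \<le> 3 \<Longrightarrow> 1 \<le> k \<Longrightarrow> t \<in> J \<Longrightarrow>
      NK (nderiv I k (K i) t) \<le> nderiv J k (\<lambda>s. NK (K i s)) t"
    and C_pos: "0 < C" and smooth_M: "smooth_within J M"
    and M_pos: "t \<in> J \<Longrightarrow> 0 < nderiv J k M t"
    and M_ode: "t \<in> J \<Longrightarrow> C / (3 * sqrt 2) * nderiv J 1 M t = (\<Sum>i\<le>3. NK (K i t) * nderiv J i M t)"
    and M_t0: "M t0 = 1"
    and H0_le: "t \<in> J \<Longrightarrow> N (nderiv I k (H 0) t) \<le> C * nderiv J k M t"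
    and antisymmetric_part_le: "N (H (Suc n) t0 ** matrix_inv (\<sigma>1 t0)
        - (-1) ^ n *\<^sub>R (matrix_inv (\<sigma>1 t0) ** ctrans (H (Suc n) t0)))
      \<le> fnum (N (matrix_inv (\<sigma>1 t0))) (Suc n) * C ^ (n + 2)"
  using majorized unfolding majorized_vessel_def Let_def by (simp_all del: fnum.simps(2))

lemma invertible_\<sigma>1: "t \<in> J \<Longrightarrow> invertible (\<sigma>1 t)"
  using vessel J_subset by (auto simp: vessel_parameters_def)

lemma NK_nonneg: "0 \<le> NK L"
proof -
  have tri: "NK (L + L') \<le> NK L + NK L'" and scale: "NK (c *\<^sub>R L) = \<bar>c\<bar> * NK L" and "NK 0 = 0"
    for L L' :: "'n cmat \<Rightarrow>\<^sub>L 'n cmat" and c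
    using NK by (auto simp: consistent_norm_def)
  thus ?thesis using tri[of L "- L"] scale[of "-1" L] by simp
qed

lemma size_factor_ge: "N (matrix_inv (\<sigma>1 t0)) \<le> r" "N (\<sigma>1 t0) * N (matrix_inv (\<sigma>1 t0)) \<le> r"
  by (simp_all add: size_factor_def)

lemma size_factor_ge_1: "1 \<le> r"
proof -
  have "1 \<le> N (mat 1)" by (rule N_mat_1_ge)
  also have "\<dots> = N (\<sigma>1 t0 ** matrix_inv (\<sigma>1 t0))"
    using invertible_\<sigma>1[of t0] t0_less_T by (simp add: matrix_inv_right)
  also have "\<dots> \<le> r"
    by (rule order_trans[OF N_mult size_factor_ge(2)])
  finally show ?thesis .
qed

text \<open>At the initial point, \<open>2 H \<sigma>1\<^sup>-\<^sup>1\<close> is the sum of its two parts: one is prescribed by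
  the quadratic relation for the moments, the other one is bounded by assumption. The two bounds
  are instances of the same convolution, and passing from \<open>H \<sigma>1\<^sup>-\<^sup>1\<close> back to \<open>H\<close> costs
  the factor \<open>\<parallel>\<sigma>1\<parallel>\<close>, absorbed by the replacement of \<open>\<parallel>\<sigma>1\<^sup>-\<^sup>1\<parallel>\<close> with \<open>r\<close> in the convolution.\<close>

lemma initial_moment_le: "N (H n t0) \<le> fnum r n * C ^ (n + 1)"
proof (induction n rule: less_induct)
  case (less n)
  show ?case
  proof (cases n)
    case 0
    thus ?thesis using H0_le[of t0 0] M_t0 t0_less_T by simp
  next
    case (Suc m)
    define R where "R = matrix_inv (\<sigma>1 t0)"
    define A where "A = H n t0 ** R"
    define B where "B = (-1) ^ m *\<^sub>R (R ** ctrans (H n t0))"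
    define S where "S = (\<Sum>j\<le>m. fnum r (m - j) * fnum r j)"
    have t0: "t0 \<in> I" using J_subset t0_less_T by auto
    have \<rho>r: "N R \<le> r" and s\<rho>r: "N (\<sigma>1 t0) * N R \<le> r"
      using size_factor_ge by (auto simp: R_def)
    have "A + B = (\<Sum>j\<le>m. (-1) ^ (j + 1) *\<^sub>R (H (m - j) t0 ** R ** ctrans (H j t0)))"
      using moments t0 Suc by (simp add: A_def B_def R_def vessel_moments_def Let_def)
    also have "N \<dots> \<le> (\<Sum>j\<le>m. N R * (fnum r (m - j) * fnum r j) * C ^ (m + 2))"
    proof (intro order_trans[OF N_sum] sum_mono)
      fix j assume j: "j \<in> {..m}"
      have "N ((-1) ^ (j + 1) *\<^sub>R (H (m - j) t0 ** R ** ctrans (H j t0)))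
          = N (H (m - j) t0 ** R ** ctrans (H j t0))"
        unfolding N_scaleR by (simp add: power_abs)
      also have "\<dots> \<le> N (H (m - j) t0 ** R) * N (H j t0)"
        using N_mult[of "H (m - j) t0 ** R" "ctrans (H j t0)"] by (simp add: N_ctrans)
      also have "\<dots> \<le> (N (H (m - j) t0) * N R) * N (H j t0)"
        by (intro mult_right_mono N_mult N_nonneg)
      also have "\<dots> \<le> ((fnum r (m - j) * C ^ (m - j + 1)) * N R) * (fnum r j * C ^ (j + 1))"
        using j Suc size_factor_ge_1 C_pos less.IH[of "m - j"] less.IH[of j]
        by (intro mult_mono mult_right_mono mult_nonneg_nonneg fnum_nonneg) auto
      also have "\<dots> = N R * (fnum r (m - j) * fnum r j) * (C ^ (m - j + 1) * C ^ (j + 1))"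
        by (simp add: mult_ac)
      also have "C ^ (m - j + 1) * C ^ (j + 1) = C ^ (m + 2)"
        using j by (subst power_add[symmetric]) (rule arg_cong[of _ _ "\<lambda>k. C ^ k"], simp)
      finally show "N ((-1) ^ (j + 1) *\<^sub>R (H (m - j) t0 ** R ** ctrans (H j t0)))
        \<le> N R * (fnum r (m - j) * fnum r j) * C ^ (m + 2)" .
    qed
    also have "\<dots> = N R * S * C ^ (m + 2)"
      by (simp add: S_def sum_distrib_left sum_distrib_right)
    finally have sum_le: "N (A + B) \<le> N R * S * C ^ (m + 2)" .
    have "N (A - B) \<le> fnum (N R) (Suc m) * C ^ (m + 2)"
      using antisymmetric_part_le[of m] Suc by (simp add: A_def B_def R_def)
    also have "\<dots> \<le> N R * S * C ^ (m + 2)"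
    proof (intro mult_right_mono)
      have "(\<Sum>j\<le>m. fnum (N R) (m - j) * fnum (N R) j) \<le> S"
        unfolding S_def using \<rho>r order_trans[OF N_nonneg \<rho>r]
        by (intro sum_mono mult_mono fnum_mono fnum_nonneg) auto
      thus "fnum (N R) (Suc m) \<le> N R * S" by (simp add: mult_left_mono)
    qed (use C_pos in auto)
    finally have diff_le: "N (A - B) \<le> N R * S * C ^ (m + 2)" .
    have "2 * N A = N ((A + B) + (A - B))"
      using N_scaleR[of 2 A] by (simp add: scaleR_2)
    also have "\<dots> \<le> N (A + B) + N (A - B)" by (rule N_triangle)
    finally have A_le: "N A \<le> N R * S * C ^ (m + 2)" using sum_le diff_le by simp
    have "R ** \<sigma>1 t0 = mat 1"
      using invertible_\<sigma>1[of t0] t0_less_T by (simp add: R_def matrix_inv_left)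
    hence "H n t0 = A ** \<sigma>1 t0" by (simp add: A_def flip: matrix_mul_assoc)
    hence "N (H n t0) \<le> N A * N (\<sigma>1 t0)" by (simp add: N_mult)
    also have "\<dots> \<le> N R * S * C ^ (m + 2) * N (\<sigma>1 t0)"
      by (intro mult_right_mono A_le N_nonneg)
    also have "\<dots> = (N (\<sigma>1 t0) * N R) * (S * C ^ (m + 2))" by (simp add: mult_ac)
    also have "\<dots> \<le> r * (S * C ^ (m + 2))"
    proof (intro mult_right_mono s\<rho>r mult_nonneg_nonneg)
      show "0 \<le> S" unfolding S_def
        using size_factor_ge_1 by (intro sum_nonneg mult_nonneg_nonneg fnum_nonneg) auto
    qed (use C_pos in auto)
    also have "\<dots> = fnum r n * C ^ (n + 1)" by (simp add: Suc S_def)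
    finally show ?thesis .
  qed
qed

text \<open>Differentiating the recursion for the moments and the equation for \<open>M\<close> in the same way,
  each derivative of \<open>H n\<close> of positive order gains the factor \<open>C / (3 \<surd>2)\<close>.\<close>

lemma moment_derivative_step:
  assumes le: "\<And>k t. t \<in> J \<Longrightarrow> N (nderiv I k (H n) t) \<le> c * nderiv J k M t" and t: "t \<in> J"
  shows "N (nderiv I (Suc k) (H (Suc n)) t) \<le> c * (C / (3 * sqrt 2)) * nderiv J (Suc k) M t"
proof -
  define h where "h = (\<lambda>n k. nderiv I k (H n))"
  define \<kappa> where "\<kappa> = (\<lambda>i k. nderiv I k (K i))"
  define \<nu> where "\<nu> = (\<lambda>i k. nderiv J k (\<lambda>s. NK (K i s)))"
  define \<mu> where "\<mu> = (\<lambda>k. nderiv J k M)"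
  have h: "jet_on J (h n)" for n
    unfolding h_def by (rule jet_on_subset[OF jet_on_nderiv[OF smooth_H] J_subset])
  have \<kappa>: "jet_on J (\<kappa> i)" if "i \<le> 3" for i
    unfolding \<kappa>_def by (rule jet_on_subset[OF jet_on_nderiv[OF smooth_K[OF that]] J_subset])
  have \<nu>: "jet_on J (\<nu> i)" if "i \<le> 3" for i
    unfolding \<nu>_def by (rule jet_on_nderiv[OF smooth_NK[OF that]])
  have \<mu>: "jet_on J \<mu>"
    unfolding \<mu>_def by (rule jet_on_nderiv[OF smooth_M])
  have h_Suc: "h (Suc n) (Suc k) t
      = (\<Sum>i\<le>3. leibniz blinfun_apply (\<lambda>m. \<kappa> i m t) (\<lambda>m. h n m t) k 0 i)"
  proof (rule jet_on_unique[OF t0_less_T _ _ _ t, where F = "\<lambda>k. h (Suc n) (Suc k)"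
        and G = "\<lambda>k t. \<Sum>i\<le>3. leibniz blinfun_apply (\<lambda>m. \<kappa> i m t) (\<lambda>m. h n m t) k 0 i"])
    show "jet_on J (\<lambda>k. h (Suc n) (Suc k))" by (rule jet_on_Suc[OF h])
    show "jet_on J (\<lambda>k t. \<Sum>i\<le>3. leibniz blinfun_apply (\<lambda>m. \<kappa> i m t) (\<lambda>m. h n m t) k 0 i)"
      by (intro jet_on_sum jet_on_leibniz bounded_bilinear_blinfun_apply \<kappa> h) simp
  next
    fix s assume "s \<in> J"
    thus "h (Suc n) (Suc 0) s
        = (\<Sum>i\<le>3. leibniz blinfun_apply (\<lambda>m. \<kappa> i m s) (\<lambda>m. h n m s) 0 0 i)"
      using coefficients J_subset by (auto simp: moment_coefficients_def h_def \<kappa>_def)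
  qed
  have \<mu>_Suc: "C / (3 * sqrt 2) * \<mu> (Suc k) t
      = (\<Sum>i\<le>3. leibniz (*) (\<lambda>m. \<nu> i m t) (\<lambda>m. \<mu> m t) k 0 i)"
  proof (rule jet_on_unique[OF t0_less_T _ _ _ t, where F = "\<lambda>k t. C / (3 * sqrt 2) * \<mu> (Suc k) t"
        and G = "\<lambda>k t. \<Sum>i\<le>3. leibniz (*) (\<lambda>m. \<nu> i m t) (\<lambda>m. \<mu> m t) k 0 i"])
    show "jet_on J (\<lambda>k t. C / (3 * sqrt 2) * \<mu> (Suc k) t)"
      by (rule jet_on_bounded_linear[OF bounded_linear_mult_right jet_on_Suc[OF \<mu>]])
    show "jet_on J (\<lambda>k t. \<Sum>i\<le>3. leibniz (*) (\<lambda>m. \<nu> i m t) (\<lambda>m. \<mu> m t) k 0 i)"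
      by (intro jet_on_sum jet_on_leibniz bounded_bilinear_mult \<nu> \<mu>) simp
  next
    fix s assume "s \<in> J"
    thus "C / (3 * sqrt 2) * \<mu> (Suc 0) s
        = (\<Sum>i\<le>3. leibniz (*) (\<lambda>m. \<nu> i m s) (\<lambda>m. \<mu> m s) 0 0 i)"
      using M_ode[of s] by (simp add: \<mu>_def \<nu>_def)
  qed
  have "N (h (Suc n) (Suc k) t)
      \<le> (\<Sum>i\<le>3. N (leibniz blinfun_apply (\<lambda>m. \<kappa> i m t) (\<lambda>m. h n m t) k 0 i))"
    unfolding h_Suc by (rule N_sum)
  also have "\<dots> \<le> (\<Sum>i\<le>3. leibniz (*) (\<lambda>m. \<nu> i m t) (\<lambda>m. c * \<mu> m t) k 0 i)"
  proof (intro sum_mono leibniz_majorant[where ?N1.0 = NK and ?N2.0 = N])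
    fix i m :: nat assume "i \<in> {..3}"
    thus "NK (\<kappa> i m t) \<le> \<nu> i m t"
      using NK_nderiv[of i m t] t by (cases m) (auto simp: \<kappa>_def \<nu>_def)
  next
    show "N (blinfun_apply L A) \<le> NK L * N A" for L A
      using NK by (simp add: consistent_norm_def)
  qed (use le[OF t] in \<open>auto simp: h_def \<mu>_def N_triangle NK_nonneg\<close>)
  also have "\<dots> = c * (C / (3 * sqrt 2) * \<mu> (Suc k) t)"
    unfolding \<mu>_Suc leibniz_scale by (simp add: sum_distrib_left)
  finally show ?thesis by (simp add: h_def \<mu>_def)
qed

text \<open>For derivatives of positive order, the gain \<open>C / (3 \<surd>2) \<le> C\<close> suffices because the
  Catalan numbers increase. The moment itself is its initial value plus the integral of its
  derivative, bounded by \<open>M(t\<^sub>0) = 1\<close> and \<open>M(t) - M(t\<^sub>0)\<close> respectively.\<close>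

lemma moment_le: "t \<in> J \<Longrightarrow> N (nderiv I k (H n) t) \<le> fnum r n * C ^ (n + 1) * nderiv J k M t"
proof (induction n arbitrary: k t)
  case 0
  thus ?case using H0_le by simp
next
  case (Suc n)
  define c where "c = fnum r (Suc n) * C ^ (Suc n + 1)"
  have C3: "C / (3 * sqrt 2) \<le> C"
  proof -
    have "1 \<le> 3 * sqrt 2" using real_sqrt_ge_1_iff[of 2] by linarith
    thus ?thesis using C_pos by (simp add: divide_le_eq)
  qed
  have "fnum r n * C ^ (n + 1) * (C / (3 * sqrt 2)) \<le> fnum r n * C ^ (n + 1) * C"
    using C_pos size_factor_ge_1 by (intro mult_left_mono C3 mult_nonneg_nonneg fnum_nonneg) auto
  also have "\<dots> = fnum r n * C ^ (Suc n + 1)" by simp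
  also have "\<dots> \<le> c"
    unfolding c_def using C_pos size_factor_ge_1 by (intro mult_right_mono fnum_le_Suc) auto
  finally have gain: "fnum r n * C ^ (n + 1) * (C / (3 * sqrt 2)) \<le> c" .
  have c_pos: "0 < c"
    unfolding c_def using C_pos fnum_ge_1[OF size_factor_ge_1, of "Suc n"]
    by (intro mult_pos_pos) (auto simp del: fnum.simps)
  have deriv_le: "N (nderiv I (Suc k) (H (Suc n)) s) \<le> c * nderiv J (Suc k) M s" if s: "s \<in> J" for k s
    using moment_derivative_step[OF Suc.IH s, of k] mult_right_mono[OF gain, of "nderiv J (Suc k) M s"]
      M_pos[OF s, of "Suc k"] by (simp del: fnum.simps power_Suc)
  show ?case
  proof (cases k)
    case (Suc k')
    thus ?thesis using deriv_le[OF Suc.prems, of k'] by (simp add: c_def del: fnum.simps power_Suc)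
  next
    case 0
    have "N (H (Suc n) t) \<le> c * M t"
    proof (cases "t = t0")
      case True
      thus ?thesis using initial_moment_le[of "Suc n"] M_t0 by (simp add: c_def del: fnum.simps power_Suc)
    next
      case False
      hence t: "t0 < t" "{t0..t} \<subseteq> J" using Suc.prems by auto
      have "N (H (Suc n) t - H (Suc n) t0) \<le> c * M t - c * M t0"
      proof (rule mean_value_inequality[OF t(1), where m' = "\<lambda>s. c * nderiv J 1 M s"
            and h' = "nderiv I 1 (H (Suc n))"])
        fix s assume s: "s \<in> {t0..t}"
        hence sJ: "s \<in> J" using t by auto
        show "(H (Suc n) has_vector_derivative nderiv I 1 (H (Suc n)) s) (at s within {t0..t})"
          using jet_onD[OF jet_on_subset[OF jet_on_nderiv[OF smooth_H[of "Suc n"]] order_trans[OF t(2) J_subset]] s, of 0]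
          by simp
        have "(M has_vector_derivative nderiv J 1 M s) (at s within {t0..t})"
          using jet_onD[OF jet_on_subset[OF jet_on_nderiv[OF smooth_M] t(2)] s, of 0] by auto
        thus "((\<lambda>t. c * M t) has_vector_derivative c * nderiv J 1 M s) (at s within {t0..t})"
          by (rule bounded_linear.has_vector_derivative[OF bounded_linear_mult_right])
        show "N (nderiv I 1 (H (Suc n)) s) \<le> c * nderiv J 1 M s"
          using deriv_le[OF sJ, of 0] by simp
        show "0 < c * nderiv J 1 M s" using c_pos M_pos[OF sJ] by simp
      qed
      moreover have "N (H (Suc n) t0) \<le> c"
        using initial_moment_le[of "Suc n"] by (simp add: c_def del: fnum.simps power_Suc)
      moreover have "N (H (Suc n) t) \<le> N (H (Suc n) t - H (Suc n) t0) + N (H (Suc n) t0)"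
        using N_triangle[of "H (Suc n) t - H (Suc n) t0" "H (Suc n) t0"] by simp
      ultimately show ?thesis using M_t0 by simp
    qed
    thus ?thesis using 0 by (simp add: c_def del: fnum.simps power_Suc)
  qed
qed

lemma moments_geometric_growth:
  "\<exists>D\<ge>0. \<forall>n. \<forall>t\<in>J. norm (H n t) \<le> D * (4 * C * r) ^ n \<and> norm (nderiv I 1 (H n) t) \<le> D * (4 * C * r) ^ n"
proof -
  obtain B where B: "0 < B" and norm_le: "\<And>A. norm A \<le> B * N A"
    using norm_le_N by blast
  have "\<exists>b\<ge>0. \<forall>t\<in>J. nderiv J k M t \<le> b" for k
  proof -
    have "continuous_on J (nderiv J k M)"
      using jet_onD[OF jet_on_nderiv[OF smooth_M]]
      by (meson continuous_on_eq_continuous_within has_vector_derivative_continuous)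
    hence "bounded (nderiv J k M ` J)"
      by (intro compact_imp_bounded compact_continuous_image) auto
    then obtain b where "\<forall>t\<in>J. \<bar>nderiv J k M t\<bar> \<le> b" by (auto simp: bounded_iff)
    hence "\<forall>t\<in>J. nderiv J k M t \<le> max b 0" by (auto intro: order_trans[OF abs_ge_self] simp: le_max_iff_disj)
    thus ?thesis by (intro exI[of _ "max b 0"]) auto
  qed
  then obtain b where b0: "\<And>k. 0 \<le> b k" and b: "\<And>k t. t \<in> J \<Longrightarrow> nderiv J k M t \<le> b k" by metis
  define D where "D = B * (2 * C) * (b 0 + b 1)"
  have r1: "1 \<le> r" by (rule size_factor_ge_1)
  have bound: "norm (nderiv I k (H n) t) \<le> D * (4 * C * r) ^ n" if t: "t \<in> J" and k: "k = 0 \<or> k = 1" for n k t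
  proof -
    have "norm (nderiv I k (H n) t) \<le> B * N (nderiv I k (H n) t)" by (rule norm_le)
    also have "\<dots> \<le> B * (fnum r n * C ^ (n + 1) * nderiv J k M t)"
      using B moment_le[OF t] by (intro mult_left_mono) auto
    also have "\<dots> \<le> B * (2 * (4 * r) ^ n * C ^ (n + 1) * (b 0 + b 1))"
    proof (intro mult_left_mono mult_mono)
      show "fnum r n \<le> 2 * (4 * r) ^ n" using r1 by (intro fnum_le_power) auto
      show "nderiv J k M t \<le> b 0 + b 1" using b[OF t, of k] b0[of 0] b0[of 1] k by auto
      show "0 \<le> nderiv J k M t" using M_pos[OF t, of k] by simp
    qed (use B C_pos r1 in auto)
    also have "\<dots> = D * (4 * C * r) ^ n" by (simp add: D_def power_mult_distrib)
    finally show ?thesis .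
  qed
  have "0 \<le> D" using B C_pos b0[of 0] b0[of 1] by (simp add: D_def)
  moreover have "norm (H n t) \<le> D * (4 * C * r) ^ n" if "t \<in> J" for n t
    using bound[OF that, of 0 n] by simp
  ultimately show ?thesis using bound by blast
qed

end

section \<open>Transfer functions of moments of geometric growth\<close>

lemmas matrix_mult_sums_left =
  bounded_linear.sums[OF bounded_bilinear.bounded_linear_left[OF bounded_bilinear_matrix_mult]]

lemmas matrix_mult_sums_right =
  bounded_linear.sums[OF bounded_bilinear.bounded_linear_right[OF bounded_bilinear_matrix_mult]]

lemma matrix_Cauchy_product_sums:
  fixes a b :: "nat \<Rightarrow> 'n::finite cmat"
  assumes a: "summable (\<lambda>n. norm (a n))" and b: "summable (\<lambda>n. norm (b n))"
    and A: "a sums A" and B: "b sums B"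
  shows "(\<lambda>k. \<Sum>i\<le>k. a i ** b (k - i)) sums (A ** B)"
  unfolding sums_def
proof (intro vec_tendstoI)
  fix p q
  have abs_summable: "summable (\<lambda>n. norm (f n $ i $ j))" if "summable (\<lambda>n. norm (f n))"
    for f :: "nat \<Rightarrow> 'n cmat" and i j
    by (rule summable_comparison_test'[OF that])
       (auto intro: order_trans[OF Finite_Cartesian_Product.norm_nth_le Finite_Cartesian_Product.norm_nth_le])
  have entry: "(\<Sum>n. f n $ i $ j) = F $ i $ j" if "f sums F" for f :: "nat \<Rightarrow> 'n cmat" and F i j
    using bounded_linear.sums[OF bounded_linear_matrix_nth that] by (rule sums_unique[symmetric])
  have "(\<lambda>k. \<Sum>i\<le>k. a i $ p $ l * b (k - i) $ l $ q) sums (A $ p $ l * B $ l $ q)" for l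
    using Cauchy_product_sums[OF abs_summable[OF a] abs_summable[OF b], of p l l q]
    by (simp add: entry[OF A] entry[OF B])
  hence "(\<lambda>k. \<Sum>l\<in>UNIV. \<Sum>i\<le>k. a i $ p $ l * b (k - i) $ l $ q) sums (\<Sum>l\<in>UNIV. A $ p $ l * B $ l $ q)"
    by (intro sums_sum)
  moreover have "(\<Sum>l\<in>UNIV. \<Sum>i\<le>k. a i $ p $ l * b (k - i) $ l $ q) = (\<Sum>i\<le>k. a i ** b (k - i)) $ p $ q" for k
    by (subst sum.swap) (simp add: matrix_matrix_mult_def)
  ultimately show "((\<lambda>n. (\<Sum>k<n. \<Sum>i\<le>k. a i ** b (k - i)) $ p $ q) \<longlongrightarrow> (A ** B) $ p $ q) sequentially"
    by (simp add: sums_def matrix_matrix_mult_def)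
qed

lemma geometric_growth_summable:
  fixes h :: "nat \<Rightarrow> 'n::finite cmat"
  assumes "\<And>n. norm (h n) \<le> D * q ^ n" "0 < q" "q < cmod z"
  shows "summable (\<lambda>n. norm (cscale (1 / z ^ (n + 1)) (h n)))"
proof (rule summable_comparison_test'[of "\<lambda>n. D / cmod z * (q / cmod z) ^ n"])
  show "summable (\<lambda>n. D / cmod z * (q / cmod z) ^ n)"
    using assms by (intro summable_mult summable_geometric) (auto simp: divide_less_eq)
next
  fix n
  have z: "0 < cmod z" using assms by linarith
  have "norm (h n) / cmod z ^ (n + 1) \<le> D * q ^ n / cmod z ^ (n + 1)"
    using z assms(1) by (intro divide_right_mono) auto
  thus "norm (norm (cscale (1 / z ^ (n + 1)) (h n))) \<le> D / cmod z * (q / cmod z) ^ n"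
    by (simp add: norm_divide norm_mult norm_power power_divide)
qed

locale geometric_moments =
  fixes H :: "nat \<Rightarrow> real \<Rightarrow> 'n::finite cmat" and t D q :: real
  assumes growth: "norm (H n t) \<le> D * q ^ n" and q_pos: "0 < q"
begin

lemma transfer_series:
  assumes "q < cmod z"
  shows "summable (\<lambda>n. norm (cscale (1 / z ^ (n + 1)) (H n t)))"
    and "summable (\<lambda>n. cscale (1 / z ^ (n + 1)) (H n t))"
    and "(\<lambda>n. cscale (1 / z ^ (n + 1)) (H n t)) sums (mat 1 - transfer_fn H z t)"
proof -
  show *: "summable (\<lambda>n. norm (cscale (1 / z ^ (n + 1)) (H n t)))"
    by (rule geometric_growth_summable[OF growth q_pos assms])
  thus **: "summable (\<lambda>n. cscale (1 / z ^ (n + 1)) (H n t))"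
    by (rule summable_norm_cancel)
  show "(\<lambda>n. cscale (1 / z ^ (n + 1)) (H n t)) sums (mat 1 - transfer_fn H z t)"
    using summable_sums[OF **] by (simp add: transfer_fn_def)
qed

lemma transfer_power_series:
  assumes "q < cmod z"
  shows "summable (\<lambda>n. norm (cscale ((1 / z) ^ n) (transfer_coeff H t n)))"
    and "(\<lambda>n. cscale ((1 / z) ^ n) (transfer_coeff H t n)) sums transfer_fn H z t"
proof -
  have Suc: "cscale ((1 / z) ^ Suc n) (transfer_coeff H t (Suc n)) = - cscale (1 / z ^ (n + 1)) (H n t)" for n
    by (simp add: transfer_coeff_def power_divide vec_eq_iff)
  show "summable (\<lambda>n. norm (cscale ((1 / z) ^ n) (transfer_coeff H t n)))"
    using transfer_series(1)[OF assms]
    by (subst summable_Suc_iff[symmetric]) (simp only: Suc norm_minus_cancel)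
  have "(\<lambda>n. cscale ((1 / z) ^ Suc n) (transfer_coeff H t (Suc n))) sums (transfer_fn H z t - mat 1)"
    using sums_minus[OF transfer_series(3)[OF assms]] by (simp only: Suc minus_diff_eq)
  from sums_Suc[OF this] show "(\<lambda>n. cscale ((1 / z) ^ n) (transfer_coeff H t n)) sums transfer_fn H z t"
    by (simp add: transfer_coeff_def cscale_def vec_eq_iff)
qed

lemma conv_radius_transfer_coeff: "ereal (1 / q) \<le> conv_radius (transfer_coeff H t)"
proof -
  \<comment> \<open>The radius depends on the norms only, which brings the root test back to a real series.\<close>
  have "ereal (1 / q) \<le> conv_radius (\<lambda>n. norm (transfer_coeff H t n))"
  proof (rule conv_radius_geI_ex')
    fix x :: real assume x: "0 < x" "ereal x < ereal (1 / q)"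
    have "q < cmod (of_real (1 / x))"
      using x q_pos by (simp add: norm_divide field_simps)
    from transfer_power_series(1)[OF this]
    show "summable (\<lambda>n. norm (transfer_coeff H t n) * of_real x ^ n)"
      using x by (simp add: norm_power mult.commute flip: of_real_power)
  qed
  thus ?thesis by (simp add: conv_radius_def)
qed

lemma transfer_analytic_at_infinity: "analytic_at_infinity (\<lambda>z. transfer_fn H z t)"
  unfolding analytic_at_infinity_def
proof (intro allI)
  fix i j
  define g where "g = (\<lambda>w. \<Sum>n. transfer_coeff H t n $ i $ j * w ^ n)"
  have sums: "(\<lambda>n. transfer_coeff H t n $ i $ j * (1 / z) ^ n) sums (transfer_fn H z t $ i $ j)"
    if "q < cmod z" for z
    using bounded_linear.sums[OF bounded_linear_matrix_nth transfer_power_series(2)[OF that], of i j]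
    by (simp add: mult.commute)
  have "g holomorphic_on ball 0 (1 / q)"
  proof (rule power_series_holomorphic)
    fix w :: complex assume w: "w \<in> ball 0 (1 / q)"
    have "summable (\<lambda>n. transfer_coeff H t n $ i $ j * w ^ n)"
    proof (cases "w = 0")
      case False
      hence "q < cmod (1 / w)" using w q_pos by (simp add: norm_divide field_simps)
      from sums_summable[OF sums[OF this]] show ?thesis by simp
    qed simp
    thus "(\<lambda>n. transfer_coeff H t n $ i $ j * (w - 0) ^ n) sums g w"
      by (simp add: g_def summable_sums)
  qed
  hence "g analytic_on {0}"
    using q_pos by (subst analytic_at) (meson centre_in_ball open_ball zero_less_divide_1_iff)
  moreover have "eventually (\<lambda>z. transfer_fn H z t $ i $ j = g (1 / z)) at_infinity"
    unfolding eventually_at_infinity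
  proof (intro exI[of _ "q + 1"] allI impI)
    fix z :: complex assume "q + 1 \<le> norm z"
    hence "q < cmod z" by simp
    from sums_unique[OF sums[OF this]] show "transfer_fn H z t $ i $ j = g (1 / z)"
      by (simp add: g_def)
  qed
  ultimately show "\<exists>g. g analytic_on {0} \<and> (\<forall>\<^sub>F z in at_infinity. transfer_fn H z t $ i $ j = g (1 / z))"
    by blast
qed

end

text \<open>The quadratic relations say that, as formal power series in \<open>1/\<lambda>\<close>,
  \<open>S(\<lambda>) R S(- cnj \<lambda>)\<^sup>* = R\<close>: this is the coefficient of \<open>\<lambda>\<^sup>-\<^sup>k\<close>.\<close>

lemma symmetry_coefficients:
  fixes H :: "nat \<Rightarrow> real \<Rightarrow> 'n::finite cmat" and t :: real
  defines "c \<equiv> transfer_coeff H t"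
  assumes H0: "H 0 t ** R - R ** ctrans (H 0 t) = 0"
    and HSuc: "\<And>n. H (Suc n) t ** R + (-1) ^ n *\<^sub>R (R ** ctrans (H (Suc n) t))
      = (\<Sum>j\<le>n. (-1) ^ (j + 1) *\<^sub>R (H (n - j) t ** R ** ctrans (H j t)))"
  shows "(\<Sum>i\<le>k. (-1) ^ (k - i) *\<^sub>R (c i ** R ** ctrans (c (k - i)))) = (if k = 0 then R else 0)"
proof -
  have c0: "c 0 = mat 1" and cSuc: "\<And>n. c (Suc n) = - H n t"
    by (simp_all add: c_def transfer_coeff_def)
  have mult_minus: "(- A) ** B = - (A ** B)" "A ** (- B) = - (A ** B)" for A B :: "'n cmat"
    using matrix_mult_scaleR_left[of "-1" A B] matrix_mult_scaleR_right[of A "-1" B] by simp_all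
  consider "k = 0" | "k = Suc 0" | n where "k = Suc (Suc n)"
    by (metis not0_implies_Suc)
  thus ?thesis
  proof cases
    case 1
    thus ?thesis by (simp add: c0)
  next
    case 2
    thus ?thesis using H0 by (simp add: c0 cSuc mult_minus ctrans_minus)
  next
    case 3
    let ?f = "\<lambda>i. (-1) ^ (k - i) *\<^sub>R (c i ** R ** ctrans (c (k - i)))"
    have "(\<Sum>i\<le>k. ?f i) = ?f 0 + (\<Sum>i\<le>n. ?f (Suc i)) + ?f k"
      unfolding 3 sum.atMost_Suc_shift[of _ "Suc n"] by (simp add: sum.atMost_Suc add.assoc)
    also have "?f 0 = - ((-1) ^ n *\<^sub>R (R ** ctrans (H (Suc n) t)))"
      by (simp add: 3 c0 cSuc ctrans_minus mult_minus)
    also have "?f k = - (H (Suc n) t ** R)"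
      by (simp add: 3 c0 cSuc mult_minus)
    also have "(\<Sum>i\<le>n. ?f (Suc i)) = (\<Sum>j\<le>n. (-1) ^ (j + 1) *\<^sub>R (H (n - j) t ** R ** ctrans (H j t)))"
    proof (rule sum.reindex_bij_witness[of _ "\<lambda>j. n - j" "\<lambda>j. n - j"])
      fix i assume i: "i \<in> {..n}"
      hence "k - Suc i = Suc (n - i)" by (simp add: 3 Suc_diff_le)
      thus "(-1) ^ (n - i + 1) *\<^sub>R (H (n - (n - i)) t ** R ** ctrans (H (n - i) t)) = ?f (Suc i)"
        using i by (simp add: cSuc ctrans_minus mult_minus)
    qed auto
    also have "\<dots> = H (Suc n) t ** R + (-1) ^ n *\<^sub>R (R ** ctrans (H (Suc n) t))"
      by (rule HSuc[symmetric])
    finally show ?thesis by (simp add: 3)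
  qed
qed

context geometric_moments
begin

lemma transfer_symmetry_product:
  assumes z: "q < cmod z"
    and H0: "H 0 t ** R - R ** ctrans (H 0 t) = 0"
    and HSuc: "\<And>n. H (Suc n) t ** R + (-1) ^ n *\<^sub>R (R ** ctrans (H (Suc n) t))
      = (\<Sum>j\<le>n. (-1) ^ (j + 1) *\<^sub>R (H (n - j) t ** R ** ctrans (H j t)))"
  shows "transfer_fn H z t ** R ** ctrans (transfer_fn H (- cnj z) t) = R"
proof -
  define c where "c = transfer_coeff H t"
  define a where "a = (\<lambda>n. cscale ((1 / z) ^ n) (c n))"
  define b where "b = (\<lambda>n. cscale ((1 / (- cnj z)) ^ n) (c n))"
  have z': "q < cmod (- cnj z)" using z by simp
  have a: "summable (\<lambda>n. norm (a n))" "a sums transfer_fn H z t"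
    using transfer_power_series[OF z] by (simp_all add: a_def c_def)
  have b: "summable (\<lambda>n. norm (b n))" "b sums transfer_fn H (- cnj z) t"
    using transfer_power_series[OF z'] by (simp_all add: b_def c_def)
  have aR: "summable (\<lambda>n. norm (a n ** R))"
    by (rule summable_comparison_test'[OF summable_mult2[OF a(1), of "norm R"]])
       (simp add: norm_matrix_mult_le)
  have bs: "summable (\<lambda>n. norm (ctrans (b n)))" using b(1) by simp
  have "(\<lambda>k. \<Sum>i\<le>k. (a i ** R) ** ctrans (b (k - i)))
      sums (transfer_fn H z t ** R ** ctrans (transfer_fn H (- cnj z) t))"
    by (rule matrix_Cauchy_product_sums[OF aR bs matrix_mult_sums_left[OF a(2)]
          bounded_linear.sums[OF bounded_linear_ctrans b(2)]])
  moreover have "(\<Sum>i\<le>k. (a i ** R) ** ctrans (b (k - i))) = (if k = 0 then R else 0)" for k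
  proof -
    have summand: "(a i ** R) ** ctrans (b (k - i))
        = cscale ((1 / z) ^ k) ((-1) ^ (k - i) *\<^sub>R (c i ** R ** ctrans (c (k - i))))" if "i \<le> k" for i
    proof -
      have "cnj ((1 / (- cnj z)) ^ (k - i)) = (1 / z) ^ (k - i) * of_real ((-1) ^ (k - i))"
        by (simp add: power_mult_distrib[symmetric])
      moreover have "(1 / z) ^ k = (1 / z) ^ i * (1 / z) ^ (k - i)"
        using that by (simp flip: power_add)
      ultimately show ?thesis
        by (simp only: a_def b_def ctrans_cscale cscale_mult_left cscale_mult_right cscale_cscale
            cscale_of_real[symmetric] mult_ac)
    qed
    have "(\<Sum>i\<le>k. (a i ** R) ** ctrans (b (k - i)))
        = cscale ((1 / z) ^ k) (\<Sum>i\<le>k. (-1) ^ (k - i) *\<^sub>R (c i ** R ** ctrans (c (k - i))))"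
      by (simp add: summand bounded_linear.linear[OF bounded_linear_cscale] linear_sum)
    also have "\<dots> = (if k = 0 then R else 0)"
      unfolding c_def symmetry_coefficients[where H = H and t = t and R = R, OF H0 HSuc] by (simp add: vec_eq_iff)
    finally show ?thesis .
  qed
  ultimately have "(\<lambda>k. if k = 0 then R else 0) sums
      (transfer_fn H z t ** R ** ctrans (transfer_fn H (- cnj z) t))" by simp
  moreover have "(\<lambda>k::nat. if k = 0 then R else 0) sums R"
    by (rule sums_single)
  ultimately show ?thesis by (rule sums_unique2)
qed

lemma transfer_symmetric:
  assumes z: "q < cmod z" and \<sigma>: "invertible \<sigma>"
    and H0: "H 0 t ** matrix_inv \<sigma> - matrix_inv \<sigma> ** ctrans (H 0 t) = 0"
    and HSuc: "\<And>n. H (Suc n) t ** matrix_inv \<sigma> + (-1) ^ n *\<^sub>R (matrix_inv \<sigma> ** ctrans (H (Suc n) t))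
      = (\<Sum>j\<le>n. (-1) ^ (j + 1) *\<^sub>R (H (n - j) t ** matrix_inv \<sigma> ** ctrans (H j t)))"
  shows "invertible (transfer_fn H (- cnj z) t)"
    and "transfer_fn H z t
      = matrix_inv \<sigma> ** ctrans (matrix_inv (transfer_fn H (- cnj z) t)) ** \<sigma>"
proof -
  define R where "R = matrix_inv \<sigma>"
  define S where "S = transfer_fn H z t"
  define W where "W = transfer_fn H (- cnj z) t"
  have R: "\<sigma> ** R = mat 1" "R ** \<sigma> = mat 1"
    using \<sigma> by (simp_all add: R_def matrix_inv_right matrix_inv_left)
  have "S ** R ** ctrans W = R"
    unfolding S_def W_def R_def by (rule transfer_symmetry_product[OF z H0 HSuc])
  hence "(\<sigma> ** S ** R) ** ctrans W = mat 1"
    using R(1) by (simp flip: matrix_mul_assoc)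
  \<comment> \<open>For square matrices this one-sided inverse of \<open>ctrans W\<close> yields an inverse of \<open>W\<close>.\<close>
  hence "ctrans ((\<sigma> ** S ** R) ** ctrans W) = ctrans (mat 1)" by simp
  hence W: "W ** ctrans (\<sigma> ** S ** R) = mat 1"
    by (simp only: ctrans_mult[of _ "ctrans W"] ctrans_ctrans ctrans_mat_1)
  show "invertible W" by (rule right_inverse_imp_matrix_inv(1)[OF W])
  have "R ** ctrans (matrix_inv W) ** \<sigma> = (R ** \<sigma>) ** S ** (R ** \<sigma>)"
    by (simp add: right_inverse_imp_matrix_inv(2)[OF W] matrix_mul_assoc)
  thus "S = R ** ctrans (matrix_inv W) ** \<sigma>" by (simp add: R(2))
qed

end

text \<open>The linear relations for the moments compare the coefficients of the identity below, whose
  left-hand side is \<open>\<lambda> \<sigma>2 S - \<sigma>1 S' - \<sigma>1 S R (\<lambda> \<sigma>2 + \<gamma>) + \<gamma>\<^sub>* S\<close> with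
  \<open>P = I - S\<close>. Multiplication by \<open>\<lambda>\<close> shifts the series, which couples consecutive moments.\<close>

lemma intertwining_identity:
  fixes \<sigma>1 \<sigma>2 \<gamma> \<gamma>s P P' :: "'n::finite cmat" and h h' :: "nat \<Rightarrow> 'n cmat"
  defines "R \<equiv> matrix_inv \<sigma>1"
  assumes z: "z \<noteq> 0" and \<sigma>1: "invertible \<sigma>1"
    and h0: "\<gamma>s - \<gamma> = \<sigma>2 ** h 0 - \<sigma>1 ** h 0 ** R ** \<sigma>2"
    and hSuc: "\<And>n. R ** \<sigma>2 ** h (Suc n) - h (Suc n) ** R ** \<sigma>2
        = h' n - R ** \<gamma>s ** h n + h n ** R ** \<gamma>"
    and P: "(\<lambda>n. cscale (1 / z ^ (n + 1)) (h n)) sums P"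
    and P': "(\<lambda>n. cscale (1 / z ^ (n + 1)) (h' n)) sums P'"
  shows "(\<gamma>s - \<gamma>) + (\<sigma>1 ** P' - \<gamma>s ** P + \<sigma>1 ** P ** R ** \<gamma>)
    + cscale z (\<sigma>1 ** P ** R ** \<sigma>2 - \<sigma>2 ** P) = 0"
proof -
  have R: "\<sigma>1 ** R = mat 1"
    using \<sigma>1 by (simp add: R_def matrix_inv_right)
  define L where "L = (\<lambda>A. \<sigma>1 ** A ** R ** \<sigma>2 - \<sigma>2 ** A)"
  define G where "G = (\<lambda>A A'. \<sigma>1 ** A' - \<gamma>s ** A + \<sigma>1 ** A ** R ** \<gamma>)"
  have cL: "cscale c (L A) = L (cscale c A)" for c A
    by (simp add: L_def cscale_mult_left cscale_mult_right vec_eq_iff right_diff_distrib)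
  have cG: "cscale c (G A A') = G (cscale c A) (cscale c A')" for c A A'
    by (simp add: G_def cscale_mult_left cscale_mult_right vec_eq_iff right_diff_distrib distrib_left)
  have LSuc: "L (h (Suc n)) = - G (h n) (h' n)" for n
  proof -
    have "\<sigma>1 ** (R ** \<sigma>2 ** h (Suc n) - h (Suc n) ** R ** \<sigma>2)
        = \<sigma>1 ** (h' n - R ** \<gamma>s ** h n + h n ** R ** \<gamma>)" by (simp add: hSuc)
    hence "(\<sigma>1 ** R) ** \<sigma>2 ** h (Suc n) - \<sigma>1 ** h (Suc n) ** R ** \<sigma>2
        = \<sigma>1 ** h' n - (\<sigma>1 ** R) ** \<gamma>s ** h n + \<sigma>1 ** h n ** R ** \<gamma>"
      by (simp only: matrix_mult_diff_right matrix_mult_add_right matrix_mul_assoc)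
    from arg_cong[OF this, of uminus] show ?thesis by (simp add: R L_def G_def algebra_simps)
  qed
  have "(\<lambda>n. cscale z (L (cscale (1 / z ^ (n + 1)) (h n)))) sums cscale z (L P)"
    unfolding L_def
    by (intro bounded_linear.sums[OF bounded_linear_cscale] sums_diff matrix_mult_sums_left
        matrix_mult_sums_right P)
  hence "(\<lambda>n. cscale (1 / z ^ n) (L (h n))) sums cscale z (L P)"
    using z by (simp flip: cL)
  hence "(\<lambda>n. cscale (1 / z ^ Suc n) (L (h (Suc n)))) sums (cscale z (L P) - L (h 0))"
    by (subst sums_Suc_iff) (simp add: vec_eq_iff)
  hence shifted: "(\<lambda>n. - cscale (1 / z ^ (n + 1)) (G (h n) (h' n))) sums (cscale z (L P) - L (h 0))"
    by (simp add: LSuc vec_eq_iff cscale_def uminus_vec_def)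
  have "(\<lambda>n. - G (cscale (1 / z ^ (n + 1)) (h n)) (cscale (1 / z ^ (n + 1)) (h' n))) sums (- G P P')"
    unfolding G_def
    by (intro sums_minus sums_add sums_diff matrix_mult_sums_left matrix_mult_sums_right P P')
  hence "(\<lambda>n. - cscale (1 / z ^ (n + 1)) (G (h n) (h' n))) sums (- G P P')"
    by (simp only: cG)
  with shifted have "cscale z (L P) - L (h 0) = - G P P'" by (rule sums_unique2)
  moreover have "L (h 0) = - (\<gamma>s - \<gamma>)" by (simp add: h0 L_def)
  ultimately have "(\<gamma>s - \<gamma>) + G P P' + cscale z (L P) = 0" by (simp add: algebra_simps)
  thus ?thesis by (simp add: L_def G_def)
qed

text \<open>Termwise differentiation, by uniform convergence of the series of derivatives.\<close>

lemma transfer_fn_has_vector_derivative: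
  fixes H :: "nat \<Rightarrow> real \<Rightarrow> 'n::finite cmat"
  assumes "convex J" and t: "t \<in> J" and q: "0 < q" "q < cmod z"
    and H': "\<And>n s. s \<in> J \<Longrightarrow> (H n has_vector_derivative H' n s) (at s within J)"
    and growth: "\<And>n s. s \<in> J \<Longrightarrow> norm (H n s) \<le> D * q ^ n"
    and growth': "\<And>n s. s \<in> J \<Longrightarrow> norm (H' n s) \<le> D * q ^ n"
  shows "((\<lambda>s. transfer_fn H z s) has_vector_derivative
    - (\<Sum>n. cscale (1 / z ^ (n + 1)) (H' n t))) (at t within J)"
proof -
  have D: "0 \<le> D" using order_trans[OF norm_ge_zero growth[OF t, of 0]] by simp
  define f where "f = (\<lambda>n s. cscale (1 / z ^ (n + 1)) (H n s))"
  define f' where "f' = (\<lambda>n s. cscale (1 / z ^ (n + 1)) (H' n s))"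
  have limit: "uniform_limit J (\<lambda>n s. \<Sum>i<n. f' i s) (\<lambda>s. \<Sum>i. f' i s) sequentially"
  proof (rule Weierstrass_m_test)
    show "norm (f' n s) \<le> D * q ^ n / cmod z ^ (n + 1)" if "s \<in> J" for n s
      using growth'[OF that, of n] q
      by (auto simp: f'_def norm_divide norm_power norm_mult intro!: divide_right_mono)
    have "summable (\<lambda>n. D / cmod z * (q / cmod z) ^ n)"
      using q by (intro summable_mult summable_geometric) (auto simp: divide_less_eq)
    thus "summable (\<lambda>n. D * q ^ n / cmod z ^ (n + 1))"
      by (simp add: power_divide)
  qed
  have "\<exists>g. \<forall>s\<in>J. (\<lambda>n. f n s) sums g s \<and> (g has_derivative (\<lambda>x. x *\<^sub>R (\<Sum>i. f' i s))) (at s within J)"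
  proof (rule has_derivative_series[OF \<open>convex J\<close>, where f' = "\<lambda>n s x. x *\<^sub>R f' n s"])
    show "(f n has_derivative (\<lambda>x. x *\<^sub>R f' n s)) (at s within J)" if "s \<in> J" for n s
      using bounded_linear.has_vector_derivative[OF bounded_linear_cscale H'[OF that]]
      by (simp add: f_def f'_def has_vector_derivative_def)
    show "(\<lambda>n. f n t) sums (\<Sum>n. f n t)"
      unfolding f_def
      by (intro summable_sums summable_norm_cancel[OF geometric_growth_summable[OF growth[OF t] q]])
    fix e :: real assume "0 < e"
    show "\<forall>\<^sub>F n in sequentially. \<forall>s\<in>J. \<forall>x. norm ((\<Sum>i<n. x *\<^sub>R f' i s) - x *\<^sub>R (\<Sum>i. f' i s)) \<le> e * norm x"
      using uniform_limitD[OF limit \<open>0 < e\<close>]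
    proof eventually_elim
      case (elim n)
      show ?case
      proof (intro ballI allI)
        fix s x assume "s \<in> J"
        hence "norm ((\<Sum>i<n. f' i s) - (\<Sum>i. f' i s)) \<le> e"
          using elim by (simp add: dist_norm less_imp_le)
        hence "\<bar>x\<bar> * norm ((\<Sum>i<n. f' i s) - (\<Sum>i. f' i s)) \<le> \<bar>x\<bar> * e"
          by (intro mult_left_mono) auto
        thus "norm ((\<Sum>i<n. x *\<^sub>R f' i s) - x *\<^sub>R (\<Sum>i. f' i s)) \<le> e * norm x"
          by (simp add: mult.commute flip: scaleR_sum_right scaleR_diff_right)
      qed
    qed
  qed (rule t)
  then obtain g where g: "\<And>s. s \<in> J \<Longrightarrow> (\<lambda>n. f n s) sums g s"
    and g': "(g has_vector_derivative (\<Sum>i. f' i t)) (at t within J)"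
    using t by (auto simp: has_vector_derivative_def)
  have deriv: "((\<lambda>s. mat 1 - g s) has_vector_derivative 0 - (\<Sum>i. f' i t)) (at t within J)"
    by (intro has_vector_derivative_diff has_vector_derivative_const g')
  have eq: "transfer_fn H z s = mat 1 - g s" if "s \<in> J" for s
    using sums_unique[OF g[OF that]] by (simp add: transfer_fn_def f_def)
  from has_vector_derivative_transform[OF t eq deriv] show ?thesis
    by (simp only: f'_def diff_0)
qed

lemma transfer_fn_intertwines:
  fixes \<sigma>1 \<sigma>2 \<gamma> \<gamma>s :: "real \<Rightarrow> 'n::finite cmat"
  assumes moments: "vessel_moments I \<sigma>1 \<sigma>2 \<gamma> \<gamma>s H"
    and J: "convex J" "J \<subseteq> I" and q: "0 < q" "q < cmod z"
    and \<sigma>1: "\<And>s. s \<in> J \<Longrightarrow> invertible (\<sigma>1 s)"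
    and H': "\<And>n s. s \<in> J \<Longrightarrow> (H n has_vector_derivative nderiv I 1 (H n) s) (at s within J)"
    and growth: "\<And>n s. s \<in> J \<Longrightarrow> norm (H n s) \<le> D * q ^ n"
    and growth': "\<And>n s. s \<in> J \<Longrightarrow> norm (nderiv I 1 (H n) s) \<le> D * q ^ n"
    and u: "solves_vessel_ode J \<sigma>1 \<sigma>2 \<gamma> z u"
  shows "solves_vessel_ode J \<sigma>1 \<sigma>2 \<gamma>s z (\<lambda>t. transfer_fn H z t *v u t)"
  unfolding solves_vessel_ode_def
proof (intro ballI)
  fix t assume t: "t \<in> J"
  define R where "R = matrix_inv (\<sigma>1 t)"
  define S where "S = transfer_fn H z t"
  define P where "P = (\<Sum>n. cscale (1 / z ^ (n + 1)) (H n t))"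
  define P' where "P' = (\<Sum>n. cscale (1 / z ^ (n + 1)) (nderiv I 1 (H n) t))"
  have S_P: "S = mat 1 - P" by (simp add: S_def P_def transfer_fn_def)
  have R: "\<sigma>1 t ** R = mat 1" "R ** \<sigma>1 t = mat 1"
    using \<sigma>1[OF t] by (simp_all add: R_def matrix_inv_right matrix_inv_left)
  have S': "((\<lambda>s. transfer_fn H z s) has_vector_derivative - P') (at t within J)"
    unfolding P'_def by (rule transfer_fn_has_vector_derivative[OF J(1) t q H' growth growth'])
  obtain u' where u': "(u has_vector_derivative u') (at t within J)"
    and ode: "z *s (\<sigma>2 t *v u t) - \<sigma>1 t *v u' + \<gamma> t *v u t = 0"
    using u t by (auto simp: solves_vessel_ode_def)
  have "\<sigma>1 t *v u' = (cscale z (\<sigma>2 t) + \<gamma> t) *v u t"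
    using ode by (simp add: cscale_matrix_vector matrix_vector_mult_add_rdistrib algebra_simps)
  hence "R *v (\<sigma>1 t *v u') = R *v ((cscale z (\<sigma>2 t) + \<gamma> t) *v u t)" by simp
  hence u'_eq: "u' = (R ** (cscale z (\<sigma>2 t) + \<gamma> t)) *v u t"
    by (simp add: matrix_vector_mul_assoc R)
  have "\<gamma>s t - \<gamma> t + (\<sigma>1 t ** P' - \<gamma>s t ** P + \<sigma>1 t ** P ** R ** \<gamma> t)
      + cscale z (\<sigma>1 t ** P ** R ** \<sigma>2 t - \<sigma>2 t ** P) = 0"
    unfolding R_def
  proof (rule intertwining_identity)
    show "z \<noteq> 0" using q by auto
    show "(\<lambda>n. cscale (1 / z ^ (n + 1)) (H n t)) sums P"
      unfolding P_def
      by (intro summable_sums summable_norm_cancel[OF geometric_growth_summable[OF growth[OF t] q]])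
    show "(\<lambda>n. cscale (1 / z ^ (n + 1)) (nderiv I 1 (H n) t)) sums P'"
      unfolding P'_def
      by (intro summable_sums summable_norm_cancel[OF geometric_growth_summable[OF growth'[OF t] q]])
  qed (use moments J t \<sigma>1[OF t] in \<open>auto simp: vessel_moments_def Let_def\<close>)
  moreover have "cscale z (\<sigma>2 t ** S) - \<sigma>1 t ** (- P' + S ** (R ** (cscale z (\<sigma>2 t) + \<gamma> t))) + \<gamma>s t ** S
      = \<gamma>s t - \<gamma> t + (\<sigma>1 t ** P' - \<gamma>s t ** P + \<sigma>1 t ** P ** R ** \<gamma> t)
      + cscale z (\<sigma>1 t ** P ** R ** \<sigma>2 t - \<sigma>2 t ** P)"
  proof -
    have minus: "\<sigma>1 t ** (- P') = - (\<sigma>1 t ** P')"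
      using matrix_mult_scaleR_right[of "\<sigma>1 t" "-1" P'] by simp
    have cdiff: "cscale z (A - B) = cscale z A - cscale z B" for A B :: "'n cmat"
      by (simp add: vec_eq_iff right_diff_distrib)
    show ?thesis
      unfolding S_P
      by (simp add: matrix_mult_diff_left matrix_mult_diff_right matrix_mult_add_right minus cdiff
          cscale_mult_left cscale_mult_right matrix_mul_assoc R)
  qed
  ultimately have identity:
    "cscale z (\<sigma>2 t ** S) - \<sigma>1 t ** (- P' + S ** (R ** (cscale z (\<sigma>2 t) + \<gamma> t))) + \<gamma>s t ** S = 0"
    by simp
  have "((\<lambda>s. transfer_fn H z s *v u s) has_vector_derivative S *v u' + (- P') *v u t) (at t within J)"
    unfolding S_def by (rule bounded_bilinear.has_vector_derivative[OF bounded_bilinear_matrix_vector S' u'])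
  moreover have "z *s (\<sigma>2 t *v (S *v u t)) - \<sigma>1 t *v (S *v u' + (- P') *v u t) + \<gamma>s t *v (S *v u t)
      = (cscale z (\<sigma>2 t ** S) - \<sigma>1 t ** (- P' + S ** (R ** (cscale z (\<sigma>2 t) + \<gamma> t))) + \<gamma>s t ** S) *v u t"
    unfolding u'_eq cscale_matrix_vector
    by (simp only: matrix_vector_mul_assoc matrix_vector_mult_add_rdistrib matrix_vector_mult_diff_rdistrib
        matrix_mult_add_right matrix_vector_right_distrib cscale_mult_left add.commute)
  ultimately show "\<exists>y'. ((\<lambda>t. transfer_fn H z t *v u t) has_vector_derivative y') (at t within J) \<and>
      z *s (\<sigma>2 t *v (transfer_fn H z t *v u t)) - \<sigma>1 t *v y' + \<gamma>s t *v (transfer_fn H z t *v u t) = 0"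
    using identity by (intro exI conjI) (auto simp: S_def)
qed

section \<open>The transfer function of majorized moments\<close>

context majorized_moments
begin

lemma growth_rate_pos: "0 < 4 * C * r"
  using C_pos size_factor_ge_1 by simp

lemma vessel_moments_at:
  assumes "t \<in> J"
  shows "H 0 t ** matrix_inv (\<sigma>1 t) - matrix_inv (\<sigma>1 t) ** ctrans (H 0 t) = 0"
    and "H (Suc n) t ** matrix_inv (\<sigma>1 t) + (-1) ^ n *\<^sub>R (matrix_inv (\<sigma>1 t) ** ctrans (H (Suc n) t))
      = (\<Sum>j\<le>n. (-1) ^ (j + 1) *\<^sub>R (H (n - j) t ** matrix_inv (\<sigma>1 t) ** ctrans (H j t)))"
  using moments J_subset assms by (auto simp: vessel_moments_def Let_def)

lemma ex_geometric_moments: "t \<in> J \<Longrightarrow> \<exists>D. geometric_moments H t D (4 * C * r)"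
  using moments_geometric_growth growth_rate_pos unfolding geometric_moments_def by blast

lemma transfer_fn_maps_solutions:
  assumes z: "4 * C * r < cmod z" and u: "solves_vessel_ode J \<sigma>1 \<sigma>2 \<gamma> z u"
  shows "solves_vessel_ode J \<sigma>1 \<sigma>2 \<gamma>s z (\<lambda>t. transfer_fn H z t *v u t)"
proof -
  obtain D where D: "\<And>n t. t \<in> J \<Longrightarrow> norm (H n t) \<le> D * (4 * C * r) ^ n"
    "\<And>n t. t \<in> J \<Longrightarrow> norm (nderiv I 1 (H n) t) \<le> D * (4 * C * r) ^ n"
    using moments_geometric_growth by blast
  have H': "(H n has_vector_derivative nderiv I 1 (H n) s) (at s within J)" if "s \<in> J" for n s
    using jet_onD[OF jet_on_subset[OF jet_on_nderiv[OF smooth_H[of n]] J_subset] that, of 0] by simp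
  show ?thesis
    by (rule transfer_fn_intertwines[OF moments _ J_subset growth_rate_pos z invertible_\<sigma>1 H' D u]) simp
qed

end

section \<open>A transfer function that is not contractive\<close>

lemma jet_on_const: "jet_on X (\<lambda>k t. if k = 0 then c else 0)"
  by (auto simp: jet_on_def)

lemma nderiv_const: "t \<in> {0..1} \<Longrightarrow> nderiv {0..1} k (\<lambda>_. c) t = (if k = 0 then c else 0)"
  by (rule nderiv_jet[OF _ jet_on_const]) auto

lemma smooth_within_const: "smooth_within {0..1} (\<lambda>_. c)"
  by (rule smooth_within_jet[OF _ jet_on_const[of _ c]]) auto

lemma jet_on_exp: "jet_on X (\<lambda>k. exp :: real \<Rightarrow> real)"
  unfolding jet_on_def
  by (auto simp flip: has_real_derivative_iff_has_vector_derivative intro!: derivative_eq_intros)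

lemma nderiv_exp: "t \<in> {0..1} \<Longrightarrow> nderiv {0..1} k (exp :: real \<Rightarrow> real) t = exp t"
  by (rule nderiv_jet[OF _ jet_on_exp]) auto

lemma smooth_within_exp: "smooth_within {0..1} (exp :: real \<Rightarrow> real)"
  by (rule smooth_within_jet[OF _ jet_on_exp]) auto

text \<open>The moments of the scalar transfer function \<open>(\<lambda> + b) / (\<lambda> - b)\<close>, which is symmetric and,
  having its pole in the right half plane, has modulus greater than \<open>1\<close> there.\<close>

definition blaschke_moment :: "real \<Rightarrow> nat \<Rightarrow> real \<Rightarrow> 'n::finite cmat" where
  "blaschke_moment b n t = (- 2 * b ^ (n + 1)) *\<^sub>R mat 1"

text \<open>The moments being constant, the coefficients only have to make \<open>M = exp\<close> a solution of
  the majorant equation for \<open>C = 1\<close>.\<close>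

definition blaschke_coefficient :: "nat \<Rightarrow> real \<Rightarrow> 'n::finite cmat \<Rightarrow>\<^sub>L 'n cmat" where
  "blaschke_coefficient i t = (if i = 1 then (1 / (3 * sqrt 2)) *\<^sub>R id_blinfun else 0)"

lemma alternating_sum: "(\<Sum>j\<le>n. (-1) ^ (j + 1)) = - (1 + (-1) ^ n) / (2 :: real)"
  by (induction n) (auto simp: field_simps)

lemma nderiv_blaschke_moment:
  "t \<in> {0..1} \<Longrightarrow> nderiv {0..1} k (blaschke_moment b n) t = (if k = 0 then blaschke_moment b n t else 0)"
  unfolding blaschke_moment_def[abs_def] by (simp add: nderiv_const)

text \<open>The measuring norm is the Frobenius norm, for which the identity has norm \<open>\<surd>p\<close> in dimension
  \<open>p\<close>. The pole \<open>b = 1/(4 p)\<close> keeps all moments below \<open>1/2\<close>, so that the required bounds, whose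
  right-hand sides are at least \<open>1\<close>, hold trivially.\<close>

lemma majorized_blaschke:
  fixes b :: real
  defines "b \<equiv> 1 / (4 * real CARD('n::finite))"
  shows "majorized_vessel {0..1} 0 1 (\<lambda>_. mat 1 :: 'n cmat) (\<lambda>_. 0) (\<lambda>_. 0) (\<lambda>_. 0)
    (blaschke_moment b) blaschke_coefficient norm norm 1 exp"
proof -
  let ?H = "blaschke_moment b :: nat \<Rightarrow> real \<Rightarrow> 'n cmat"
  let ?K = "blaschke_coefficient :: nat \<Rightarrow> real \<Rightarrow> 'n cmat \<Rightarrow>\<^sub>L 'n cmat"
  define p where "p = real CARD('n)"
  have p: "1 \<le> p" by (simp add: p_def Suc_leI)
  have sqrt_p: "1 \<le> sqrt p" "sqrt p \<le> p"
    using p by (auto intro: real_le_lsqrt simp: power2_eq_square)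
  have b_eq: "b = 1 / (4 * p)" by (simp add: b_def p_def)
  have b: "0 < b" "b \<le> 1" "4 * b * sqrt p \<le> 1"
    unfolding b_eq using p sqrt_p by (auto simp: divide_le_eq)
  have norm_H: "norm (?H n t) \<le> 1 / 2" for n t
  proof -
    have "norm (?H n t) = (4 * b * sqrt p) * b ^ n / 2"
      using b by (simp add: blaschke_moment_def norm_mat_1 p_def)
    also have "\<dots> \<le> 1 * 1 / 2"
      using b by (intro divide_right_mono mult_mono power_le_one) auto
    finally show ?thesis by simp
  qed
  have parameters: "vessel_parameters {0..1} (\<lambda>_. mat 1 :: 'n cmat) (\<lambda>_. 0) (\<lambda>_. 0) (\<lambda>_. 0)"
  proof -
    have "ctrans 0 = (0 :: 'n cmat)" by (simp add: vec_eq_iff)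
    thus ?thesis by (auto simp: vessel_parameters_def nderiv_const invertible_mat_1)
  qed
  have moments: "vessel_moments {0..1} (\<lambda>_. mat 1 :: 'n cmat) (\<lambda>_. 0) (\<lambda>_. 0) (\<lambda>_. 0) ?H"
    unfolding vessel_moments_def Let_def matrix_inv_mat_1
  proof (intro ballI conjI allI)
    fix t :: real and n assume "t \<in> {0..1}"
    have "(\<Sum>j\<le>n. (-1) ^ (j + 1) *\<^sub>R (?H (n - j) t ** mat 1 ** ctrans (?H j t)))
        = (\<Sum>j\<le>n. (-1) ^ (j + 1) * (4 * b ^ (n + 2))) *\<^sub>R mat 1"
      unfolding scaleR_sum_left
    proof (intro sum.cong refl)
      fix j assume "j \<in> {..n}"
      hence "b ^ (n - j + 1) * b ^ (j + 1) = b ^ (n + 2)"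
        by (subst power_add[symmetric]) (rule arg_cong[of _ _ "\<lambda>k. b ^ k"], simp)
      hence "(-2 * b ^ (n - j + 1)) * (-2 * b ^ (j + 1)) = 4 * b ^ (n + 2)" by simp
      thus "(-1) ^ (j + 1) *\<^sub>R (?H (n - j) t ** mat 1 ** ctrans (?H j t))
          = ((-1) ^ (j + 1) * (4 * b ^ (n + 2))) *\<^sub>R mat 1"
        by (simp only: blaschke_moment_def ctrans_scaleR ctrans_mat_1 matrix_mult_scaleR_left
            matrix_mult_scaleR_right matrix_mul_lid matrix_mul_rid scaleR_scaleR mult_ac)
    qed
    also have "(\<Sum>j\<le>n. (-1) ^ (j + 1) * (4 * b ^ (n + 2))) = (1 + (-1) ^ n) * (- 2 * b ^ (n + 2))"
    proof -
      have "(\<Sum>j\<le>n. (-1) ^ (j + 1) * (4 * b ^ (n + 2))) = (\<Sum>j\<le>n. (-1) ^ (j + 1)) * (4 * b ^ (n + 2))"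
        by (rule sum_distrib_right[symmetric])
      also have "\<dots> = (- (1 + (-1) ^ n) / 2) * (4 * b ^ (n + 2))"
        by (simp only: alternating_sum)
      finally show ?thesis by argo
    qed
    also have "\<dots> *\<^sub>R mat 1 = ?H (Suc n) t ** mat 1 + (-1) ^ n *\<^sub>R (mat 1 ** ctrans (?H (Suc n) t))"
      by (simp only: blaschke_moment_def ctrans_scaleR ctrans_mat_1 matrix_mul_lid matrix_mul_rid
          scaleR_scaleR distrib_right scaleR_add_left mult_1_left) simp
    finally show "?H (Suc n) t ** mat 1 + (-1) ^ n *\<^sub>R (mat 1 ** ctrans (?H (Suc n) t))
        = (\<Sum>j\<le>n. (-1) ^ (j + 1) *\<^sub>R (?H (n - j) t ** mat 1 ** ctrans (?H j t)))" by simp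
  qed (auto simp: nderiv_blaschke_moment blaschke_moment_def ctrans_scaleR ctrans_minus matrix_mult_zero)
  have const_K: "?K i = (\<lambda>_. ?K i 0)" for i
    by (simp add: blaschke_coefficient_def fun_eq_iff)
  have K0: "?K i t = 0" if "i \<noteq> 1" for i t
    using that by (simp add: blaschke_coefficient_def)
  have norm_K1: "norm (?K (Suc 0) t) = 1 / (3 * sqrt 2)" for t
    by (simp add: blaschke_coefficient_def)
  have coefficients: "moment_coefficients {0..1} ?H ?K"
    unfolding moment_coefficients_def
  proof (intro allI ballI)
    fix n and t :: real assume t: "t \<in> {0..1}"
    have "blinfun_apply (?K i t) (nderiv {0..1} i (?H n) t) = 0" for i
      by (cases "i = 1") (simp_all add: K0 nderiv_blaschke_moment[OF t])
    thus "nderiv {0..1} 1 (?H (Suc n)) t = (\<Sum>i\<le>3. blinfun_apply (?K i t) (nderiv {0..1} i (?H n) t))"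
      by (simp add: nderiv_blaschke_moment[OF t])
  qed
  have consistent: "consistent_norm (norm :: 'n cmat \<Rightarrow> real) norm"
    by (auto simp: consistent_norm_def norm_triangle_ineq norm_blinfun)
  have ode: "1 / (3 * sqrt 2) * nderiv {0..1} 1 exp t = (\<Sum>i\<le>3. norm (?K i t) * nderiv {0..1} i exp t)"
    if t: "t \<in> {0..1}" for t
  proof -
    have "(\<Sum>i\<le>3. norm (?K i t) * nderiv {0..1} i exp t) = (\<Sum>i\<le>(3::nat). if i = 1 then 1 / (3 * sqrt 2) * exp t else 0)"
      by (intro sum.cong refl) (auto simp: K0 norm_K1 nderiv_exp[OF t])
    also have "\<dots> = 1 / (3 * sqrt 2) * exp t" by (subst sum.delta) auto
    finally show ?thesis by (simp only: nderiv_exp[OF t])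
  qed
  have H0: "norm (nderiv {0..1} k (?H 0) t) \<le> exp t" if t: "t \<in> {0..1}" for k t
    using t norm_H[of 0 t] one_le_exp_iff[of t] by (auto simp: nderiv_blaschke_moment[OF t] simp del: one_le_exp_iff)
  have antisymmetric: "norm (?H (Suc n) 0 ** mat 1 - (-1) ^ n *\<^sub>R (mat 1 ** ctrans (?H (Suc n) 0)))
      \<le> fnum (norm (mat 1 :: 'n cmat)) (Suc n)" for n
  proof -
    have "norm (?H (Suc n) 0 ** mat 1 - (-1) ^ n *\<^sub>R (mat 1 ** ctrans (?H (Suc n) 0)))
        \<le> norm (?H (Suc n) 0) + norm (?H (Suc n) 0)"
      by (rule order_trans[OF norm_triangle_ineq4]) simp
    also have "\<dots> \<le> 1" using norm_H[of "Suc n" 0] by simp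
    also have "\<dots> \<le> fnum (norm (mat 1 :: 'n cmat)) (Suc n)"
      using sqrt_p by (intro fnum_ge_1) (simp add: norm_mat_1 p_def)
    finally show ?thesis .
  qed
  show ?thesis
    unfolding majorized_vessel_def Let_def matrix_inv_mat_1
  proof (intro conjI allI impI ballI)
    fix i k :: nat and t :: real assume "1 \<le> k" "t \<in> {0..1}"
    thus "norm (nderiv {0..1} k (?K i) t) \<le> nderiv {0..1} k (\<lambda>s. norm (?K i s)) t"
      by (subst (1 2) const_K) (simp add: nderiv_const)
  next
    fix i :: nat
    show "smooth_within {0..1} (?K i)" "smooth_within {0..1} (\<lambda>t. norm (?K i t))"
      by (subst const_K, rule smooth_within_const)+
  next
    fix n :: nat
    show "smooth_within {0..1} (?H n)"
      unfolding blaschke_moment_def[abs_def] by (rule smooth_within_const)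
  next
    fix n :: nat
    show "norm (?H (Suc n) 0 ** mat 1 - (-1) ^ n *\<^sub>R (mat 1 ** ctrans (?H (Suc n) 0)))
        \<le> fnum (norm (mat 1 :: 'n cmat)) (Suc n) * 1 ^ (n + 2)"
      using antisymmetric[of n] by (simp only: power_one mult_1_right)
  qed (use parameters moments coefficients consistent ode H0 in
      \<open>auto simp: smooth_within_const smooth_within_exp star_matrix_norm_norm nderiv_exp is_interval_cc\<close>)
qed

lemma transfer_fn_blaschke:
  assumes "\<bar>b\<bar> < x"
  shows "transfer_fn (blaschke_moment b) (of_real x) t = ((x + b) / (x - b)) *\<^sub>R (mat 1 :: 'n::finite cmat)"
proof -
  have "(\<lambda>n. - 2 * b / x * (b / x) ^ n) sums (- 2 * b / x * (1 / (1 - b / x)))"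
    using assms by (intro sums_mult geometric_sums) auto
  also have "1 - b / x = (x - b) / x"
    using assms by (auto simp: field_simps)
  also have "- 2 * b / x * (1 / ((x - b) / x)) = - 2 * b / (x - b)"
    using assms by auto
  finally have "(\<lambda>n. (- 2 * b / x * (b / x) ^ n) *\<^sub>R (mat 1 :: 'n cmat)) sums ((- 2 * b / (x - b)) *\<^sub>R mat 1)"
    by (rule sums_scaleR_left)
  moreover have terms: "(- 2 * b / x * (b / x) ^ n) *\<^sub>R (mat 1 :: 'n cmat)
      = cscale (1 / of_real x ^ (n + 1)) (blaschke_moment b n t)" for n
  proof -
    have "1 / complex_of_real x ^ (n + 1) = of_real (1 / x ^ (n + 1))" by simp
    thus ?thesis
      by (simp only: cscale_of_real blaschke_moment_def scaleR_scaleR) (simp add: power_divide)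
  qed
  ultimately have "(\<lambda>n. cscale (1 / of_real x ^ (n + 1)) (blaschke_moment b n t))
      sums ((- 2 * b / (x - b)) *\<^sub>R (mat 1 :: 'n cmat))"
    by (simp only: terms)
  from sums_unique[OF this]
  have "(\<Sum>n. cscale (1 / of_real x ^ (n + 1)) (blaschke_moment b n t))
      = (- 2 * b / (x - b)) *\<^sub>R (mat 1 :: 'n cmat)"
    by (rule sym)
  hence "transfer_fn (blaschke_moment b) (of_real x) t = (1 - (- 2 * b / (x - b))) *\<^sub>R (mat 1 :: 'n cmat)"
    by (simp only: transfer_fn_def scaleR_diff_left scaleR_one)
  also have "1 - (- 2 * b / (x - b)) = (x + b) / (x - b)"
    using assms by (auto simp: field_simps)
  finally show ?thesis .
qed

lemma not_loewner_le_scalar: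
  assumes "1 < s"
  shows "\<not> loewner_le (ctrans (s *\<^sub>R (mat 1 :: 'n::finite cmat)) ** mat 1 ** (s *\<^sub>R mat 1)) (mat 1)"
proof
  define v :: "complex^'n" where "v = (\<chi> i. 1)"
  define A :: "'n cmat" where "A = mat 1 - ctrans (s *\<^sub>R (mat 1 :: 'n::finite cmat)) ** mat 1 ** (s *\<^sub>R mat 1)"
  assume "loewner_le (ctrans (s *\<^sub>R (mat 1 :: 'n::finite cmat)) ** mat 1 ** (s *\<^sub>R mat 1)) (mat 1)"
  hence nonneg: "0 \<le> Re (quad_form A v)" by (simp add: loewner_le_def A_def)
  have "A = (1 - s * s) *\<^sub>R mat 1"
    by (simp add: A_def ctrans_scaleR matrix_mult_scaleR_left matrix_mult_scaleR_right scaleR_diff_left)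
  hence "A *v v = (1 - s * s) *\<^sub>R v"
    by (simp add: bounded_bilinear.scaleR_left[OF bounded_bilinear_matrix_vector])
  hence "Re (quad_form A v) = real CARD('n) * (1 - s * s)"
    by (simp add: quad_form_def v_def)
  moreover have "1 < s * s" using mult_strict_mono[of 1 s 1 s] assms by simp
  ultimately have "Re (quad_form A v) < 0" by (simp add: mult_pos_neg)
  with nonneg show False by simp
qed

section \<open>Convergence, symmetry and failure of contractivity\<close>

theorem theorem6p1:
  fixes I :: "real set" and t0 T C :: real
    and \<sigma>1 \<sigma>2 \<gamma> \<gamma>s :: "real \<Rightarrow> complex^'n::finite^'n"
    and H :: "nat \<Rightarrow> real \<Rightarrow> complex^'n^'n"
    and K :: "nat \<Rightarrow> real \<Rightarrow> (complex^'n^'n) \<Rightarrow>\<^sub>L (complex^'n^'n)"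
    and N :: "complex^'n^'n \<Rightarrow> real"
    and NK :: "((complex^'n^'n) \<Rightarrow>\<^sub>L (complex^'n^'n)) \<Rightarrow> real"
    and M :: "real \<Rightarrow> real"
  assumes "majorized_vessel I t0 T \<sigma>1 \<sigma>2 \<gamma> \<gamma>s H K N NK C M"
  shows
    "(let r = size_factor N (\<sigma>1 t0); S = transfer_fn H in
       (\<forall>t\<in>{t0..T}. analytic_at_infinity (\<lambda>z. S z t)) \<and>
       (\<forall>t\<in>{t0..T}. \<forall>z. 4 * C * r < cmod z \<longrightarrow>
          summable (\<lambda>n. cscale (1 / z ^ (n + 1)) (H n t))) \<and>
       (\<forall>z u. 4 * C * r < cmod z \<longrightarrow> solves_vessel_ode {t0..T} \<sigma>1 \<sigma>2 \<gamma> z u \<longrightarrow>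
          solves_vessel_ode {t0..T} \<sigma>1 \<sigma>2 \<gamma>s z (\<lambda>t. S z t *v u t)) \<and>
       (\<forall>t\<in>{t0..T}. \<forall>z. 4 * C * r < cmod z \<longrightarrow>
          invertible (S (- cnj z) t) \<and>
          S z t = matrix_inv (\<sigma>1 t) ** ctrans (matrix_inv (S (- cnj z) t)) ** \<sigma>1 t) \<and>
       (\<forall>t\<in>{t0..T}. ereal (1 / (4 * C * r)) \<le> conv_radius (transfer_coeff H t)) \<and>
       (N (matrix_inv (\<sigma>1 t0)) \<le> 1 \<and> N (\<sigma>1 t0) * N (matrix_inv (\<sigma>1 t0)) \<le> 1 \<longrightarrow>
          (\<forall>t\<in>{t0..T}. ereal (1 / (4 * C)) \<le> conv_radius (transfer_coeff H t))))
     \<and>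
     (\<exists>(I' :: real set) t0' T' (\<sigma>1' :: real \<Rightarrow> complex^'n^'n) \<sigma>2' \<gamma>' \<gamma>s' H' K' N' NK' C' M'.
       majorized_vessel I' t0' T' \<sigma>1' \<sigma>2' \<gamma>' \<gamma>s' H' K' N' NK' C' M' \<and>
       \<not> (\<forall>t\<in>{t0'..T'}. \<forall>z. 4 * C' * size_factor N' (\<sigma>1' t0') < cmod z \<longrightarrow> 0 < Re z \<longrightarrow>
            loewner_le (ctrans (transfer_fn H' z t) ** \<sigma>1' t ** transfer_fn H' z t) (\<sigma>1' t)))"
proof -
  interpret majorized_moments I t0 T C \<sigma>1 \<sigma>2 \<gamma> \<gamma>s H K N NK M
    using assms by unfold_locales
  have radius: "ereal (1 / (4 * C * r)) \<le> conv_radius (transfer_coeff H t)" if t: "t \<in> J" for t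
    using ex_geometric_moments[OF t] by (auto intro: geometric_moments.conv_radius_transfer_coeff)
  have symmetric: "invertible (transfer_fn H (- cnj z) t)"
    "transfer_fn H z t
      = matrix_inv (\<sigma>1 t) ** ctrans (matrix_inv (transfer_fn H (- cnj z) t)) ** \<sigma>1 t"
    if t: "t \<in> J" and z: "4 * C * r < cmod z" for t z
  proof -
    obtain D where "geometric_moments H t D (4 * C * r)"
      using ex_geometric_moments[OF t] by blast
    then interpret geometric_moments H t D "4 * C * r" .
    show "invertible (transfer_fn H (- cnj z) t)"
      "transfer_fn H z t
        = matrix_inv (\<sigma>1 t) ** ctrans (matrix_inv (transfer_fn H (- cnj z) t)) ** \<sigma>1 t"
      by (rule transfer_symmetric[OF z invertible_\<sigma>1[OF t] vessel_moments_at[OF t]])+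
  qed
  have normalized: "ereal (1 / (4 * C)) \<le> conv_radius (transfer_coeff H t)"
    if t: "t \<in> J" and "N (matrix_inv (\<sigma>1 t0)) \<le> 1" "N (\<sigma>1 t0) * N (matrix_inv (\<sigma>1 t0)) \<le> 1" for t
  proof -
    have "r = 1" using that size_factor_ge_1 by (simp add: size_factor_def)
    thus ?thesis using radius[OF t] by simp
  qed
  have first: "let r = size_factor N (\<sigma>1 t0); S = transfer_fn H in
       (\<forall>t\<in>{t0..T}. analytic_at_infinity (\<lambda>z. S z t)) \<and>
       (\<forall>t\<in>{t0..T}. \<forall>z. 4 * C * r < cmod z \<longrightarrow>
          summable (\<lambda>n. cscale (1 / z ^ (n + 1)) (H n t))) \<and>
       (\<forall>z u. 4 * C * r < cmod z \<longrightarrow> solves_vessel_ode {t0..T} \<sigma>1 \<sigma>2 \<gamma> z u \<longrightarrow>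
          solves_vessel_ode {t0..T} \<sigma>1 \<sigma>2 \<gamma>s z (\<lambda>t. S z t *v u t)) \<and>
       (\<forall>t\<in>{t0..T}. \<forall>z. 4 * C * r < cmod z \<longrightarrow>
          invertible (S (- cnj z) t) \<and>
          S z t = matrix_inv (\<sigma>1 t) ** ctrans (matrix_inv (S (- cnj z) t)) ** \<sigma>1 t) \<and>
       (\<forall>t\<in>{t0..T}. ereal (1 / (4 * C * r)) \<le> conv_radius (transfer_coeff H t)) \<and>
       (N (matrix_inv (\<sigma>1 t0)) \<le> 1 \<and> N (\<sigma>1 t0) * N (matrix_inv (\<sigma>1 t0)) \<le> 1 \<longrightarrow>
          (\<forall>t\<in>{t0..T}. ereal (1 / (4 * C)) \<le> conv_radius (transfer_coeff H t)))"
    unfolding Let_def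
  proof (intro conjI ballI allI impI)
    fix t assume "t \<in> J"
    then obtain D where D: "geometric_moments H t D (4 * C * r)"
      using ex_geometric_moments by blast
    show "analytic_at_infinity (\<lambda>z. transfer_fn H z t)"
      by (rule geometric_moments.transfer_analytic_at_infinity[OF D])
    show "summable (\<lambda>n. cscale (1 / z ^ (n + 1)) (H n t))" if "4 * C * r < cmod z" for z
      by (rule geometric_moments.transfer_series(2)[OF D that])
  qed (use radius symmetric normalized transfer_fn_maps_solutions in blast)+
  define b where "b = 1 / (4 * real CARD('n))"
  \<comment> \<open>a point of the right half plane beyond the guaranteed circle of convergence\<close>
  define x where "x = 4 * size_factor norm (mat 1 :: 'n cmat) + 1"
  have "1 \<le> real CARD('n)" by (simp add: Suc_leI)
  hence "1 < 4 * real CARD('n)" by linarith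
  hence b: "0 < b" "b < 1" unfolding b_def by (auto simp only: zero_less_divide_1_iff divide_less_eq_1_pos)
  have "0 \<le> size_factor norm (mat 1 :: 'n cmat)" by (simp add: size_factor_def le_max_iff_disj)
  hence x1: "1 \<le> x" and "4 * 1 * size_factor norm (mat 1 :: 'n cmat) < x"
    by (simp_all add: x_def)
  moreover have "cmod (of_real x) = x" using x1 by simp
  ultimately have x: "1 \<le> x" "4 * 1 * size_factor norm (mat 1 :: 'n cmat) < cmod (of_real x)"
    by simp_all
  have "1 < (x + b) / (x - b)" using b x by (simp add: field_simps)
  moreover have "transfer_fn (blaschke_moment b) (of_real x) 0 = ((x + b) / (x - b)) *\<^sub>R (mat 1 :: 'n cmat)"
    using b x by (intro transfer_fn_blaschke) simp
  ultimately have "\<not> loewner_le (ctrans (transfer_fn (blaschke_moment b) (of_real x) 0) ** mat 1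
      ** transfer_fn (blaschke_moment b) (of_real x) 0) (mat 1 :: 'n cmat)"
    using not_loewner_le_scalar by simp
  hence not_contractive: "\<not> (\<forall>t\<in>{0..1}. \<forall>z. 4 * 1 * size_factor norm (mat 1 :: 'n cmat) < cmod z \<longrightarrow> 0 < Re z \<longrightarrow>
      loewner_le (ctrans (transfer_fn (blaschke_moment b) z t) ** mat 1 ** transfer_fn (blaschke_moment b) z t)
        (mat 1 :: 'n cmat))"
    using x by (intro notI) (drule bspec[of _ _ 0], simp, drule spec[of _ "of_real x"], simp)
  have "majorized_vessel {0..1} 0 1 (\<lambda>_. mat 1 :: 'n cmat) (\<lambda>_. 0) (\<lambda>_. 0) (\<lambda>_. 0)
      (blaschke_moment b) blaschke_coefficient norm norm 1 exp"
    unfolding b_def by (rule majorized_blaschke)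
  with first not_contractive show ?thesis by blast
qed

end
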